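(* For every fixed integer $k\ge 3$, as $n\to\infty$ (for $n\gg k$), \[ \frac{A(k-2,\lfloor (k-3)/2\rfloor)\,n^{k-2}}{(k-2)!\,(k-1)!}+O(n^{k-3})\le \log_2|\mathcal{B}^*(n,k)|\le \frac{n^{k-2}}{(k-2)!}+O(n^{k-3}\log n), \] where the implied constants may depend on $k$.
   Context: $\log$ is the natural logarithm. $A(m,d)$ is the Eulerian number counting permutations in $\mathfrak{S}_m$ with exactly $d$ descents. Let $\binom{[n]}{k}$ be the set of $k$-element subsets of $[n]=\{1,\dots,n\}$, each written in increasing order. For $X=[x_1<\dots<x_m]\subseteq[n]$ its packet is $P(X)=\{X\setminus\{x_i\}:1\le i\le m\}$ and its copacket is $P^*(X)=\{X\cup\{i\}:i\in[n]\setminus X\}$. The lex order is the lexicographic order of increasing sequences and antilex is its reverse. A total order $\rho$ on $\binom{[n]}{k}$ is coadmissible if for every $X\in\binom{[n]}{k-1}$ the restriction $\rho|_{P^*(X)}$ is the lex or the antilex order on $P^*(X)$. $X,Y\in\binom{[n]}{k}$ commute if $P(X)\cap P(Y)=\varnothing$. Two coadmissible orders (written as sequences) are commutation equivalent if one is obtained from the other by a sequence of transpositions of adjacent commuting elements. The dual higher Bruhat order $\mathcal{B}^*(n,k)$ has as its underlying set the set of commutation equivalence classes of coadmissible orders on $\binom{[n]}{k}$. *)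

theory Defs
  imports
    Complex_Main
    "HOL-Library.Landau_Symbols"
    "HOL-Combinatorics.Permutations"
begin

definition eulerian :: "nat \<Rightarrow> nat \<Rightarrow> nat" where
  "eulerian m d = card {\<pi>. \<pi> permutes {1..m} \<and> card {i \<in> {1..<m}. \<pi> (Suc i) < \<pi> i} = d}"

definition ksubsets :: "nat \<Rightarrow> nat \<Rightarrow> nat set set" where
  "ksubsets n k = {X. X \<subseteq> {1..n} \<and> card X = k}"

definition packet :: "nat set \<Rightarrow> nat set set" where
  "packet X = (\<lambda>x. X - {x}) ` X"

definition copacket :: "nat \<Rightarrow> nat set \<Rightarrow> nat set set" where
  "copacket n X = (\<lambda>i. insert i X) ` ({1..n} - X)"

definition lex_less :: "nat set \<Rightarrow> nat set \<Rightarrow> bool" where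
  "lex_less X Y \<longleftrightarrow>
     (sorted_list_of_set X, sorted_list_of_set Y) \<in> lexord {(a, b). a < b}"

text \<open>A total order on a finite set is represented by the duplicate-free list of its
  elements in increasing order; filtering this list is restriction of the order.\<close>

definition total_orders :: "nat \<Rightarrow> nat \<Rightarrow> nat set list set" where
  "total_orders n k = {\<rho>. distinct \<rho> \<and> set \<rho> = ksubsets n k}"

definition coadmissible_orders :: "nat \<Rightarrow> nat \<Rightarrow> nat set list set" where
  "coadmissible_orders n k =
     {\<rho> \<in> total_orders n k. \<forall>X \<in> ksubsets n (k - 1).
        sorted_wrt lex_less (filter (\<lambda>Y. Y \<in> copacket n X) \<rho>) \<or>
        sorted_wrt (\<lambda>A B. lex_less B A) (filter (\<lambda>Y. Y \<in> copacket n X) \<rho>)}"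

definition commute :: "nat set \<Rightarrow> nat set \<Rightarrow> bool" where
  "commute X Y \<longleftrightarrow> packet X \<inter> packet Y = {}"

definition commutation_step :: "(nat set list \<times> nat set list) set" where
  "commutation_step = {(us @ X # Y # vs, us @ Y # X # vs) | us X Y vs. commute X Y}"

definition commutation_equiv :: "nat \<Rightarrow> nat \<Rightarrow> (nat set list \<times> nat set list) set" where
  "commutation_equiv n k =
     {(\<rho>, \<sigma>). \<rho> \<in> coadmissible_orders n k \<and> \<sigma> \<in> coadmissible_orders n k \<and>
              (\<rho>, \<sigma>) \<in> commutation_step\<^sup>*}"

lemma equiv_commutation_equiv: "equiv (coadmissible_orders n k) (commutation_equiv n k)"
proof (rule equivI)
  have "sym commutation_step"
    unfolding commutation_step_def commute_def by (rule symI) blast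
  then have s: "sym (commutation_step\<^sup>*)" by (rule sym_rtrancl)
  show "sym (commutation_equiv n k)"
    using s unfolding commutation_equiv_def sym_def by blast
  show "trans (commutation_equiv n k)"
    unfolding commutation_equiv_def trans_def by (auto intro: rtrancl_trans)
  show "commutation_equiv n k \<subseteq> coadmissible_orders n k \<times> coadmissible_orders n k"
    unfolding commutation_equiv_def by blast
  show "refl_on (coadmissible_orders n k) (commutation_equiv n k)"
    unfolding commutation_equiv_def refl_on_def by blast
qed

definition dual_higher_bruhat :: "nat \<Rightarrow> nat \<Rightarrow> nat set list set set" where
  "dual_higher_bruhat n k = coadmissible_orders n k // commutation_equiv n k"

end

theory Submission
  imports Defs "HOL-Library.FuncSet" "HOL-Real_Asymp.Real_Asymp"
begin

text \<open>A commutation class is determined by the set of \<open>(k-1)\<close>-sets whose copacket is ordered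
  lexicographically, since two \<open>k\<close>-sets fail to commute exactly when they lie in a common copacket.
  Regard membership in this set as a sign on \<open>(k-1)\<close>-sets.

  Upper bound: along the copacket of a \<open>(k-2)\<close>-set the sign changes at most once. For each
  \<open>(k-3)\<close>-set \<open>Z\<close> the signs of \<open>Z \<union> {x, y}\<close> with \<open>x, y > max Z\<close> thus form a graph on
  \<open>n - max Z\<close> vertices all of whose rows change at most once, and there are only
  \<open>O(n^2) * 2 ^ (n - max Z)\<close> such graphs. The exponents add up to \<open>n choose (k-2)\<close>.

  Lower bound: give sign + to the \<open>(k-1)\<close>-sets of sum \<open>< s\<close>, sign - to those of sum \<open>> s\<close> and an
  arbitrary sign to those of sum \<open>s\<close>. Sorting by \<open>s e\<^sub>1 - e\<^sub>2\<close> realises these signs. For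
  \<open>s\<close> close to \<open>(d+1) n\<close> the number of \<open>(k-1)\<close>-sets of sum \<open>s\<close> is governed by \<open>A(k-2, d)\<close>
  because a sequence of residues modulo \<open>n\<close> wraps around at its descents.\<close>


section \<open>Commutation classes as sets of faces\<close>

lemma lexord_insort:
  fixes i j :: nat
  assumes "i < j" "i \<notin> set xs"
  shows "(insort i xs, insort j xs) \<in> lexord {(a, b). a < b}"
  using assms by (induction xs) auto

lemma lex_less_insert:
  assumes "finite X" "i \<notin> X" "j \<notin> X" "i < j"
  shows "lex_less (insert i X) (insert j X)"
  using assms lexord_insort[of i j "sorted_list_of_set X"] by (simp add: lex_less_def)

lemma lex_less_asym: "lex_less X Y \<Longrightarrow> \<not> lex_less Y X"
proof -
  have "asym {(a, b). (a::nat) < b}" by (auto intro: asymI)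
  then show "lex_less X Y \<Longrightarrow> \<not> lex_less Y X"
    unfolding lex_less_def by (meson asymD lexord_asym)
qed

lemma ksubsets_finite: "X \<in> ksubsets n k \<Longrightarrow> finite X"
  unfolding ksubsets_def by (auto intro: finite_subset)

lemma finite_ksubsets [simp]: "finite (ksubsets n k)"
  unfolding ksubsets_def by simp

lemma card_ksubsets: "card (ksubsets n k) = n choose k"
  unfolding ksubsets_def using n_subsets[of "{1..n}" k] by simp

lemma insert_in_ksubsets:
  assumes "X \<in> ksubsets n k" "i \<in> {1..n} - X"
  shows "insert i X \<in> ksubsets n (Suc k)"
  using assms ksubsets_finite[OF assms(1)] unfolding ksubsets_def by auto

lemma not_commute_iff:
  assumes "A \<noteq> B"
  shows "\<not> commute A B \<longleftrightarrow> (\<exists>X i j. i \<notin> X \<and> j \<notin> X \<and> A = insert i X \<and> B = insert j X)"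
proof
  assume "\<not> commute A B"
  then obtain i j where "i \<in> A" "j \<in> B" "A - {i} = B - {j}"
    unfolding commute_def packet_def by auto
  then have "i \<notin> A - {i}" "j \<notin> A - {i}" "A = insert i (A - {i})" "B = insert j (A - {i})"
    by auto
  then show "\<exists>X i j. i \<notin> X \<and> j \<notin> X \<and> A = insert i X \<and> B = insert j X" by blast
next
  assume "\<exists>X i j. i \<notin> X \<and> j \<notin> X \<and> A = insert i X \<and> B = insert j X"
  then obtain X i j where "i \<notin> X" "j \<notin> X" "A = insert i X" "B = insert j X" by blast
  then have "X \<in> packet A" "X \<in> packet B" unfolding packet_def by auto
  then show "\<not> commute A B" unfolding commute_def by blast
qed

lemma copacket_not_commute:
  assumes "A \<in> copacket n X" "B \<in> copacket n X"
  shows "\<not> commute A B"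
proof -
  have "X \<in> packet A" "X \<in> packet B" using assms unfolding copacket_def packet_def by auto
  then show ?thesis unfolding commute_def by blast
qed

lemma copacket_subset_ksubsets:
  assumes "X \<in> ksubsets n (k - 1)" "k \<ge> 1"
  shows "copacket n X \<subseteq> ksubsets n k"
  using insert_in_ksubsets[OF assms(1)] assms(2) unfolding copacket_def by auto

text \<open>Two members of one copacket never commute, so at least one of the two sets swapped in a
  step lies outside the copacket and the filtered list stays the same.\<close>

lemma commutation_step_filter:
  assumes "(\<rho>, \<sigma>) \<in> commutation_step\<^sup>*"
  shows "filter (\<lambda>Y. Y \<in> copacket n X) \<rho> = filter (\<lambda>Y. Y \<in> copacket n X) \<sigma>"
  using assms
proof (induction rule: rtrancl_induct)
  case (step \<sigma> \<tau>)
  then obtain us A B vs where "\<sigma> = us @ A # B # vs" "\<tau> = us @ B # A # vs" "commute A B"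
    unfolding commutation_step_def by auto
  then show ?case using step.IH copacket_not_commute[of A n X B] by auto
qed simp

section \<open>The projection criterion for commutation equivalence\<close>

lemma commutation_step_Cons:
  assumes "(\<rho>, \<sigma>) \<in> commutation_step\<^sup>*"
  shows "(A # \<rho>, A # \<sigma>) \<in> commutation_step\<^sup>*"
  using assms
proof (induction rule: rtrancl_induct)
  case (step \<sigma> \<tau>)
  then obtain us X Y vs where "\<sigma> = us @ X # Y # vs" "\<tau> = us @ Y # X # vs" "commute X Y"
    unfolding commutation_step_def by auto
  then have "(A # \<sigma>, A # \<tau>) \<in> commutation_step"
    unfolding commutation_step_def by (metis (mono_tags, lifting) append_Cons mem_Collect_eq)
  then show ?case using step.IH by simp
qed simp

lemma commutation_move_front:
  assumes "\<And>B. B \<in> set us \<Longrightarrow> commute B A"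
  shows "(us @ A # vs, A # us @ vs) \<in> commutation_step\<^sup>*"
  using assms
proof (induction us)
  case (Cons B us)
  then have "(B # us @ A # vs, B # A # us @ vs) \<in> commutation_step\<^sup>*"
    by (intro commutation_step_Cons) auto
  moreover have "(B # A # us @ vs, A # B # us @ vs) \<in> commutation_step"
    unfolding commutation_step_def using Cons.prems[of B]
    by (auto intro!: exI[of _ "[]"])
  ultimately show ?case by simp
qed simp

text \<open>This is the projection lemma for partially commutative words. The head \<open>A\<close>
  of \<rho> can be moved to the front of \<sigma>, because a non-commuting \<open>B\<close> before
  \<open>A\<close> in \<sigma> would give the two projections to \<open>A\<close> and
  \<open>B\<close> different first letters.\<close>

lemma commutation_equivalent_if_same_projections:
  assumes "distinct \<rho>" "distinct \<sigma>" "set \<rho> = set \<sigma>"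
    and "\<And>A B. A \<noteq> B \<Longrightarrow> \<not> commute A B \<Longrightarrow>
           filter (\<lambda>Y. Y = A \<or> Y = B) \<rho> = filter (\<lambda>Y. Y = A \<or> Y = B) \<sigma>"
  shows "(\<sigma>, \<rho>) \<in> commutation_step\<^sup>*"
  using assms
proof (induction \<rho> arbitrary: \<sigma>)
  case (Cons A \<rho>)
  obtain us vs where \<sigma>: "\<sigma> = us @ A # vs" using Cons.prems(3) by (metis list.set_intros(1) split_list)
  have "commute B A" if "B \<in> set us" for B
  proof (rule ccontr)
    assume nc: "\<not> commute B A"
    have ne: "B \<noteq> A" "A \<notin> set us" using Cons.prems(2) that \<sigma> by auto
    have "filter (\<lambda>Y. Y = B \<or> Y = A) (A # \<rho>) = filter (\<lambda>Y. Y = B \<or> Y = A) \<sigma>"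
      using Cons.prems(4) ne nc by blast
    moreover have "hd (filter (\<lambda>Y. Y = B \<or> Y = A) \<sigma>) = B"
    proof -
      have "filter (\<lambda>Y. Y = B \<or> Y = A) us \<noteq> []" using that by (auto simp: filter_empty_conv)
      moreover have "set (filter (\<lambda>Y. Y = B \<or> Y = A) us) \<subseteq> {B}" using ne by auto
      ultimately show ?thesis unfolding \<sigma> by (metis (lifting) filter_append hd_append2 hd_in_set singletonD subsetD)
    qed
    ultimately show False using ne by (metis (mono_tags, lifting) filter.simps(2) list.sel(1))
  qed
  then have 1: "(\<sigma>, A # us @ vs) \<in> commutation_step\<^sup>*" unfolding \<sigma> by (rule commutation_move_front)
  have "(us @ vs, \<rho>) \<in> commutation_step\<^sup>*"
  proof (rule Cons.IH)
    show "distinct \<rho>" "distinct (us @ vs)" using Cons.prems \<sigma> by auto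
    have "set \<rho> = set (A # \<rho>) - {A}" "set (us @ vs) = set \<sigma> - {A}"
      using Cons.prems(1,2) unfolding \<sigma> by auto
    then show "set \<rho> = set (us @ vs)" unfolding Cons.prems(3) by (rule trans[OF _ sym])
    fix B C :: "nat set" assume "B \<noteq> C" "\<not> commute B C"
    then have eq: "filter (\<lambda>Y. Y = B \<or> Y = C) (A # \<rho>) = filter (\<lambda>Y. Y = B \<or> Y = C) \<sigma>"
      by (rule Cons.prems(4))
    have "A \<notin> set \<rho>" "A \<notin> set us" "A \<notin> set vs" using Cons.prems \<sigma> by auto
    \<comment> \<open>Deleting \<open>A\<close> is written as a filter because filters can be
      exchanged; the projections of the shorter lists then come from those of the longer
      ones.\<close>
    then have rm: "\<rho> = filter (\<lambda>Y. Y \<noteq> A) (A # \<rho>)" "us @ vs = filter (\<lambda>Y. Y \<noteq> A) \<sigma>"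
      unfolding \<sigma> by (auto intro!: filter_True[symmetric] arg_cong2[where f = append])
    have swap: "filter P (filter Q xs) = filter Q (filter P xs)" for P Q and xs :: "nat set list"
      by (simp add: conj_commute)
    have "filter (\<lambda>Y. Y = B \<or> Y = C) \<rho> = filter (\<lambda>Y. Y \<noteq> A) (filter (\<lambda>Y. Y = B \<or> Y = C) (A # \<rho>))"
      by (subst rm(1)) (rule swap)
    also have "\<dots> = filter (\<lambda>Y. Y \<noteq> A) (filter (\<lambda>Y. Y = B \<or> Y = C) \<sigma>)" unfolding eq ..
    also have "\<dots> = filter (\<lambda>Y. Y = B \<or> Y = C) (us @ vs)" by (subst rm(2)) (rule swap)
    finally show "filter (\<lambda>Y. Y = B \<or> Y = C) \<rho> = filter (\<lambda>Y. Y = B \<or> Y = C) (us @ vs)" .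
  qed
  then show ?case using 1 commutation_step_Cons by (metis rtrancl_trans)
qed simp

section \<open>Commutation classes and their lexicographic faces\<close>

lemma sorted_wrt_unique:
  assumes "\<And>x y. R x y \<Longrightarrow> \<not> R y x" "sorted_wrt R xs" "sorted_wrt R ys" "set xs = set ys"
  shows "xs = ys"
  using assms(2-)
proof (induction xs arbitrary: ys)
  case (Cons x xs)
  then obtain y ys' where ys: "ys = y # ys'" by (cases ys) auto
  have irr: "\<not> R z z" for z using assms(1) by blast
  have "x = y"
  proof (rule ccontr)
    assume "x \<noteq> y"
    then have "R x y" "R y x" using Cons.prems ys by (auto simp: set_eq_iff)
    then show False using assms(1) by blast
  qed
  moreover have "x \<notin> set xs" "y \<notin> set ys'" using Cons.prems ys irr by auto
  then have "set xs = set ys'" using Cons.prems(3) ys \<open>x = y\<close> by auto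
  ultimately show ?case using Cons ys by auto
qed simp

text \<open>The sign vector of an order, as the set of positive faces. A copacket with at most one
  element is sorted both ways and counts as lexicographic.\<close>

definition lex_faces :: "nat \<Rightarrow> nat \<Rightarrow> nat set list \<Rightarrow> nat set set" where
  "lex_faces n k \<rho> =
     {X \<in> ksubsets n (k - 1). sorted_wrt lex_less (filter (\<lambda>Y. Y \<in> copacket n X) \<rho>)}"

lemma lex_faces_commutation_step:
  "(\<rho>, \<sigma>) \<in> commutation_step\<^sup>* \<Longrightarrow> lex_faces n k \<rho> = lex_faces n k \<sigma>"
  unfolding lex_faces_def by (simp add: commutation_step_filter)

text \<open>Each copacket is sorted in one of two ways and \<open>lex_faces\<close> tells which, so
  both orders agree on every copacket and hence on every non-commuting pair.\<close>

lemma commutation_equiv_if_lex_faces_eq: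
  assumes "\<rho> \<in> coadmissible_orders n k" "\<sigma> \<in> coadmissible_orders n k"
    and eq: "lex_faces n k \<rho> = lex_faces n k \<sigma>" and k: "k \<ge> 1"
  shows "(\<rho>, \<sigma>) \<in> commutation_equiv n k"
proof -
  note adm = assms(1,2)[unfolded coadmissible_orders_def total_orders_def]
  have copacket: "filter (\<lambda>Y. Y \<in> copacket n X) \<rho> = filter (\<lambda>Y. Y \<in> copacket n X) \<sigma>"
    if X: "X \<in> ksubsets n (k - 1)" for X
  proof (cases "X \<in> lex_faces n k \<rho>")
    case True
    then have "X \<in> lex_faces n k \<sigma>" using eq by simp
    with True show ?thesis using adm unfolding lex_faces_def
      by (intro sorted_wrt_unique[of lex_less]) (auto dest: lex_less_asym)
  next
    case False
    then have "X \<notin> lex_faces n k \<sigma>" using eq by simp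
    with False show ?thesis using adm X unfolding lex_faces_def
      by (intro sorted_wrt_unique[of "\<lambda>A B. lex_less B A"]) (auto dest: lex_less_asym)
  qed
  have "(\<rho>, \<sigma>) \<in> commutation_step\<^sup>*"
  proof (rule commutation_equivalent_if_same_projections)
    show "distinct \<rho>" "distinct \<sigma>" "set \<sigma> = set \<rho>" using adm by auto
    fix A B assume AB: "A \<noteq> B" "\<not> commute A B"
    then obtain X i j where X: "i \<notin> X" "j \<notin> X" "A = insert i X" "B = insert j X"
      using not_commute_iff by metis
    show "filter (\<lambda>Y. Y = A \<or> Y = B) \<sigma> = filter (\<lambda>Y. Y = A \<or> Y = B) \<rho>"
    proof (cases "A \<in> ksubsets n k \<and> B \<in> ksubsets n k")
      case True
      have XX: "X \<in> ksubsets n (k - 1)" using True X ksubsets_finite[of A n k] unfolding ksubsets_def by auto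
      have in_cop: "A \<in> copacket n X" "B \<in> copacket n X"
        using True X unfolding copacket_def ksubsets_def by auto
      have "filter (\<lambda>Y. Y = A \<or> Y = B) \<tau> =
          filter (\<lambda>Y. Y = A \<or> Y = B) (filter (\<lambda>Y. Y \<in> copacket n X) \<tau>)" for \<tau>
        using in_cop by (auto intro: filter_cong)
      then show ?thesis using copacket[OF XX] by metis
    next
      \<comment> \<open>The projection criterion ranges over arbitrary sets. If \<open>A\<close> or
        \<open>B\<close> is not a \<open>k\<close>-subset of \<open>{1..n}\<close>, at most one of
        them, called \<open>C\<close>, can occur in the lists.\<close>
      case False
      have single: "filter (\<lambda>Y. Y = A \<or> Y = B) \<tau> = filter (\<lambda>Y. Y = C) \<tau>"
        if "\<And>Y. Y \<in> set \<tau> \<Longrightarrow> (Y = A \<or> Y = B) = (Y = C)" for \<tau> C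
        using that by (rule filter_cong[OF refl])
      have filt: "filter (\<lambda>Y. Y = C) \<tau> = (if C \<in> set \<tau> then [C] else [])" if "distinct \<tau>" for \<tau> C
        using that by (induction \<tau>) auto
      obtain C where "\<And>Y. Y \<in> ksubsets n k \<Longrightarrow> (Y = A \<or> Y = B) = (Y = C)"
        using False by metis
      then show ?thesis using single[of \<rho> C] single[of \<sigma> C] filt[of \<rho> C] filt[of \<sigma> C] adm by auto
    qed
  qed
  then show ?thesis using assms unfolding commutation_equiv_def by simp
qed

lemma commutation_class_eq_iff:
  assumes "\<rho> \<in> coadmissible_orders n k" "\<sigma> \<in> coadmissible_orders n k" "k \<ge> 1"
  shows "commutation_equiv n k `` {\<rho>} = commutation_equiv n k `` {\<sigma>} \<longleftrightarrow>
    lex_faces n k \<rho> = lex_faces n k \<sigma>"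
proof -
  have "commutation_equiv n k `` {\<rho>} = commutation_equiv n k `` {\<sigma>} \<longleftrightarrow>
      (\<rho>, \<sigma>) \<in> commutation_equiv n k"
    using eq_equiv_class_iff[OF equiv_commutation_equiv assms(1,2)] by simp
  also have "\<dots> \<longleftrightarrow> lex_faces n k \<rho> = lex_faces n k \<sigma>"
    using commutation_equiv_if_lex_faces_eq[OF assms(1,2) _ assms(3)] lex_faces_commutation_step
    by (auto simp: commutation_equiv_def)
  finally show ?thesis .
qed

lemma finite_coadmissible_orders: "finite (coadmissible_orders n k)"
proof (rule finite_subset)
  show "coadmissible_orders n k \<subseteq> {\<rho>. set \<rho> \<subseteq> ksubsets n k \<and> distinct \<rho>}"
    unfolding coadmissible_orders_def total_orders_def by auto
qed (rule finite_subset_distinct, simp)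

lemma card_dual_higher_bruhat:
  assumes "k \<ge> 1"
  shows "card (dual_higher_bruhat n k) = card (lex_faces n k ` coadmissible_orders n k)"
proof -
  define cls where "cls = (\<lambda>\<rho>. commutation_equiv n k `` {\<rho>})"
  have cls: "dual_higher_bruhat n k = cls ` coadmissible_orders n k"
    unfolding dual_higher_bruhat_def quotient_def cls_def by auto
  have iff: "\<And>\<rho> \<sigma>. \<rho> \<in> coadmissible_orders n k \<Longrightarrow> \<sigma> \<in> coadmissible_orders n k \<Longrightarrow>
     cls \<rho> = cls \<sigma> \<longleftrightarrow> lex_faces n k \<rho> = lex_faces n k \<sigma>"
    unfolding cls_def using commutation_class_eq_iff assms by blast
  \<comment> \<open>Classes and face sets are images of the same orders under maps with the same
    fibres. One inequality is proved for general maps and used in both directions.\<close>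
  have "card (f ` S) \<le> card (g ` S)" if "finite S" "\<And>x y. x \<in> S \<Longrightarrow> y \<in> S \<Longrightarrow> g x = g y \<Longrightarrow> f x = f y"
    for f :: "nat set list \<Rightarrow> 'x" and g :: "nat set list \<Rightarrow> 'y" and S
  proof -
    have "f ` S \<subseteq> (\<lambda>y. f (inv_into S g y)) ` (g ` S)"
    proof
      fix z assume "z \<in> f ` S"
      then obtain x where x: "x \<in> S" "z = f x" by auto
      have "inv_into S g (g x) \<in> S" "g (inv_into S g (g x)) = g x"
        using x by (auto intro: inv_into_into f_inv_into_f)
      then have "f (inv_into S g (g x)) = f x" using that(2) x by metis
      then show "z \<in> (\<lambda>y. f (inv_into S g y)) ` (g ` S)" using x by force
    qed
    then show ?thesis using that(1) by (meson finite_imageI surj_card_le)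
  qed note le = this
  show ?thesis unfolding cls
    using iff finite_coadmissible_orders by (intro antisym le) blast+
qed

section \<open>Graphs whose rows change at most once\<close>

definition pairs :: "nat set \<Rightarrow> nat set set" where
  "pairs V = {{x, y} | x y. x \<in> V \<and> y \<in> V \<and> x \<noteq> y}"

lemma pairs_iff [simp]: "{x, y} \<in> pairs V \<longleftrightarrow> x \<in> V \<and> y \<in> V \<and> x \<noteq> y"
  unfolding pairs_def by (auto simp: doubleton_eq_iff)

lemma pairsE:
  assumes "e \<in> pairs V"
  obtains x y where "e = {x, y}" "x \<in> V" "y \<in> V" "x \<noteq> y"
  using assms unfolding pairs_def by auto

lemma finite_pairs [simp]: "finite V \<Longrightarrow> finite (pairs V)"
  unfolding pairs_def by (rule finite_subset[of _ "Pow V"]) auto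

lemma edge_sets_eqI:
  assumes "E \<subseteq> pairs V" "E' \<subseteq> pairs V"
    and "\<And>x y. x \<in> V \<Longrightarrow> y \<in> V \<Longrightarrow> x \<noteq> y \<Longrightarrow> {x, y} \<in> E \<longleftrightarrow> {x, y} \<in> E'"
  shows "E = E'"
  using assms by (blast elim: pairsE)

text \<open>Neighbourhoods are closed downwards in the order given by \<open>f\<close>, up to the
  missing loop. The order is a parameter because it is needed upwards, downwards and in the mixed
  form \<open>key\<close> below.\<close>

definition threshold_graphs :: "(nat \<Rightarrow> int) \<Rightarrow> nat set \<Rightarrow> nat set set set" where
  "threshold_graphs f V = {E. E \<subseteq> pairs V \<and>
     (\<forall>x\<in>V. \<forall>a\<in>V. \<forall>b\<in>V. x \<noteq> a \<longrightarrow> x \<noteq> b \<longrightarrow> f a < f b \<longrightarrow> {x, b} \<in> E \<longrightarrow> {x, a} \<in> E)}"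

lemma threshold_graphsD:
  assumes "E \<in> threshold_graphs f V" "x \<in> V" "a \<in> V" "b \<in> V" "x \<noteq> a" "x \<noteq> b" "f a < f b" "{x, b} \<in> E"
  shows "{x, a} \<in> E"
  using assms unfolding threshold_graphs_def by blast

lemma finite_threshold_graphs: "finite V \<Longrightarrow> finite (threshold_graphs f V)"
  unfolding threshold_graphs_def by (rule finite_subset[of _ "Pow (pairs V)"]) auto

text \<open>Peeling: the edge between the least and the greatest vertex decides whether the least
  vertex is joined to everything or the greatest one to nothing.\<close>

lemma card_threshold_graphs_le:
  assumes "finite V" "inj_on f V"
  shows "card (threshold_graphs f V) \<le> 2 ^ card V"
  using assms
proof (induction "card V" arbitrary: V)
  case 0
  then have "threshold_graphs f V \<subseteq> {{}}" unfolding threshold_graphs_def pairs_def by auto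
  then have "card (threshold_graphs f V) \<le> card {{} :: nat set set}" by (intro card_mono) auto
  then show ?case using 0 by simp
next
  case (Suc N)
  have "V \<noteq> {}" using Suc.hyps(2) by auto
  then have "Min (f ` V) \<in> f ` V" "Max (f ` V) \<in> f ` V" using Suc.prems by auto
  then obtain u v where u: "u \<in> V" "f u = Min (f ` V)" and v: "v \<in> V" "f v = Max (f ` V)"
    by (metis image_iff)
  have u_least: "f u < f w" if "w \<in> V" "w \<noteq> u" for w
    using that u Suc.prems by (metis Min_le finite_imageI imageI inj_on_contraD order_le_less)
  have v_greatest: "f w < f v" if "w \<in> V" "w \<noteq> v" for w
    using that v Suc.prems by (metis Max_ge finite_imageI imageI inj_on_contraD order_le_less)
  define star where "star = {{u, w} | w. w \<in> V - {u}}"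
  have "threshold_graphs f V \<subseteq>
    (\<lambda>E. E \<union> star) ` threshold_graphs f (V - {u}) \<union> threshold_graphs f (V - {v})"
  proof
    fix E assume E: "E \<in> threshold_graphs f V"
    then have sub: "E \<subseteq> pairs V" unfolding threshold_graphs_def by auto
    note mono = threshold_graphsD[OF E]
    show "E \<in> (\<lambda>E. E \<union> star) ` threshold_graphs f (V - {u}) \<union> threshold_graphs f (V - {v})"
    proof (cases "u = v \<or> {u, v} \<in> E")
      \<comment> \<open>Here \<open>u\<close> is joined to all other vertices and is removed
        together with \<open>star\<close>. The case \<open>u = v\<close> means a single vertex, and
        then \<open>star\<close> is empty.\<close>
      case True
      have star: "star \<subseteq> E"
      proof
        fix e assume "e \<in> star"
        then obtain w where w: "e = {u, w}" "w \<in> V" "w \<noteq> u" unfolding star_def by auto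
        show "e \<in> E"
        proof (cases "w = v")
          case False
          then have "f w < f v" "u \<noteq> v" using w v_greatest[of w] u_least[of w] by auto
          then show ?thesis using mono[of u w v] u v w True by auto
        qed (use True w in auto)
      qed
      have "E \<inter> pairs (V - {u}) \<in> threshold_graphs f (V - {u})"
        unfolding threshold_graphs_def using mono by auto
      moreover have "E = (E \<inter> pairs (V - {u})) \<union> star"
      proof (rule edge_sets_eqI[OF sub])
        show "E \<inter> pairs (V - {u}) \<union> star \<subseteq> pairs V" using sub star by auto
        fix x y assume "x \<in> V" "y \<in> V" "x \<noteq> y"
        then show "{x, y} \<in> E \<longleftrightarrow> {x, y} \<in> E \<inter> pairs (V - {u}) \<union> star"
          using star unfolding star_def by (auto simp: insert_commute)
      qed
      ultimately show ?thesis by blast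
    next
      case False
      have "{v, w} \<notin> E" if "w \<in> V" "w \<noteq> v" for w
        using mono[of v u w] that u v False u_least[of w] by (cases "w = u") (auto simp: insert_commute)
      then have "E \<subseteq> pairs (V - {v})"
        using sub by (auto elim!: pairsE dest!: subsetD) (metis insert_commute)+
      then have "E \<in> threshold_graphs f (V - {v})"
        unfolding threshold_graphs_def using mono by auto
      then show ?thesis by blast
    qed
  qed
  then have "card (threshold_graphs f V) \<le>
    card ((\<lambda>E. E \<union> star) ` threshold_graphs f (V - {u}) \<union> threshold_graphs f (V - {v}))"
    using Suc.prems by (intro card_mono) (auto simp: finite_threshold_graphs)
  also have "\<dots> \<le> card (threshold_graphs f (V - {u})) + card (threshold_graphs f (V - {v}))"
    using Suc.prems by (intro order.trans[OF card_Un_le] add_mono card_image_le)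
      (auto simp: finite_threshold_graphs)
  also have "\<dots> \<le> 2 ^ N + 2 ^ N"
  proof (rule add_mono)
    have c: "card (V - {u}) = N" "card (V - {v}) = N" using Suc u v by auto
    show "card (threshold_graphs f (V - {u})) \<le> 2 ^ N"
      using Suc.hyps(1)[of "V - {u}"] c(1) Suc.prems by (auto intro: inj_on_diff)
    show "card (threshold_graphs f (V - {v})) \<le> 2 ^ N"
      using Suc.hyps(1)[of "V - {v}"] c(2) Suc.prems by (auto intro: inj_on_diff)
  qed
  finally show ?case using Suc.hyps(2) by (simp flip: Suc.hyps(2))
qed

text \<open>The shape that remains of a graph with one change per row when its two extreme rows are
  fixed: \<open>I\<close> collects the rows that go from present to absent, \<open>J\<close> those
  that go the other way.\<close>

definition bipolar_graphs :: "nat set \<Rightarrow> nat set \<Rightarrow> nat set set set" where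
  "bipolar_graphs I J = {E. E \<subseteq> pairs (I \<union> J) \<and>
     (\<forall>x\<in>I. \<forall>a\<in>I \<union> J. \<forall>b\<in>I \<union> J. x \<noteq> a \<longrightarrow> x \<noteq> b \<longrightarrow> a < b \<longrightarrow> {x, b} \<in> E \<longrightarrow> {x, a} \<in> E) \<and>
     (\<forall>x\<in>J. \<forall>a\<in>I \<union> J. \<forall>b\<in>I \<union> J. x \<noteq> a \<longrightarrow> x \<noteq> b \<longrightarrow> a < b \<longrightarrow> {x, a} \<in> E \<longrightarrow> {x, b} \<in> E)}"

lemma finite_bipolar_graphs: "finite I \<Longrightarrow> finite J \<Longrightarrow> finite (bipolar_graphs I J)"
  unfolding bipolar_graphs_def by (rule finite_subset[of _ "Pow (pairs (I \<union> J))"]) auto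

text \<open>Without edges between \<open>I\<close> and \<open>J\<close> both sides are threshold graphs. A single such edge
  makes \<open>I\<close> and \<open>J\<close> cliques, and after removing the edges inside \<open>J\<close> a threshold graph remains
  for the order that lists \<open>I\<close> downwards and then \<open>J\<close> upwards.\<close>

lemma card_bipolar_graphs_le:
  assumes fin: "finite I" "finite J" and less: "\<And>i j. i \<in> I \<Longrightarrow> j \<in> J \<Longrightarrow> i < j"
  shows "card (bipolar_graphs I J) \<le> 2 * 2 ^ (card I + card J)"
proof -
  \<comment> \<open>Subtracting \<open>1\<close> keeps the keys on \<open>I\<close> negative, hence
    below all keys on \<open>J\<close> even if \<open>0\<close> is a vertex.\<close>
  define key :: "nat \<Rightarrow> int" where "key = (\<lambda>x. if x \<in> I then - int x - 1 else int x)"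
  have disj: "I \<inter> J = {}" using less by fastforce
  let ?T = "threshold_graphs int I \<times> threshold_graphs (\<lambda>x. - int x) J"
  let ?M = "threshold_graphs key (I \<union> J)"
  have "bipolar_graphs I J \<subseteq> (\<lambda>(E, E'). E \<union> E') ` ?T \<union> (\<lambda>E. E \<union> pairs J) ` ?M"
  proof
    fix E assume "E \<in> bipolar_graphs I J"
    then have sub: "E \<subseteq> pairs (I \<union> J)"
      and rowI: "\<And>x a b. x \<in> I \<Longrightarrow> a \<in> I \<union> J \<Longrightarrow> b \<in> I \<union> J \<Longrightarrow> x \<noteq> a \<Longrightarrow> x \<noteq> b \<Longrightarrow> a < b \<Longrightarrow>
        {x, b} \<in> E \<Longrightarrow> {x, a} \<in> E"
      and rowJ: "\<And>x a b. x \<in> J \<Longrightarrow> a \<in> I \<union> J \<Longrightarrow> b \<in> I \<union> J \<Longrightarrow> x \<noteq> a \<Longrightarrow> x \<noteq> b \<Longrightarrow> a < b \<Longrightarrow>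
        {x, a} \<in> E \<Longrightarrow> {x, b} \<in> E"
      unfolding bipolar_graphs_def by blast+
    show "E \<in> (\<lambda>(E, E'). E \<union> E') ` ?T \<union> (\<lambda>E. E \<union> pairs J) ` ?M"
    proof (cases "\<exists>i\<in>I. \<exists>j\<in>J. {i, j} \<in> E")
      case False
      have "E = E \<inter> pairs I \<union> E \<inter> pairs J"
      proof (rule edge_sets_eqI[OF sub])
        show "E \<inter> pairs I \<union> E \<inter> pairs J \<subseteq> pairs (I \<union> J)" using sub by auto
        fix x y assume "x \<in> I \<union> J" "y \<in> I \<union> J" "x \<noteq> y"
        then show "{x, y} \<in> E \<longleftrightarrow> {x, y} \<in> E \<inter> pairs I \<union> E \<inter> pairs J"
          using False by (auto simp: insert_commute)
      qed
      moreover have "E \<inter> pairs I \<in> threshold_graphs int I"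
        unfolding threshold_graphs_def using rowI by auto
      moreover have "E \<inter> pairs J \<in> threshold_graphs (\<lambda>x. - int x) J"
        unfolding threshold_graphs_def using rowJ by auto
      ultimately show ?thesis by (intro UnI1 image_eqI[of _ _ "(E \<inter> pairs I, E \<inter> pairs J)"]) auto
    next
      case True
      then obtain i0 j0 where ij: "i0 \<in> I" "j0 \<in> J" "{i0, j0} \<in> E" by blast
      \<comment> \<open>The vertices of \<open>I\<close> and \<open>J\<close> closest to each other.
        The edge \<open>{i0, j0}\<close> is moved to \<open>{u, j0}\<close> along row
        \<open>j0\<close> and then to \<open>{u, v}\<close> along row \<open>u\<close>; both cliques
        follow from \<open>{u, v}\<close>.\<close>
      define u where "u = Max I"
      define v where "v = Min J"
      have "I \<noteq> {}" "J \<noteq> {}" using ij(1,2) by auto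
      then have maxmin: "Max I \<in> I" "Min J \<in> J" using fin by auto
      have u: "u \<in> I" "\<And>i. i \<in> I \<Longrightarrow> i \<noteq> u \<Longrightarrow> i < u"
        using maxmin fin unfolding u_def by (auto simp: order_less_le)
      have v: "v \<in> J" "\<And>j. j \<in> J \<Longrightarrow> j \<noteq> v \<Longrightarrow> v < j"
        using maxmin fin unfolding v_def by (auto simp: order_less_le)
      have ne: "i \<noteq> j" "j \<noteq> i" if "i \<in> I" "j \<in> J" for i j using disj that by auto
      have "{j0, u} \<in> E"
      proof (cases "i0 = u")
        case False
        then show ?thesis using rowJ[of j0 i0 u] ij u ne[of u j0] ne[of i0 j0] by (simp add: insert_commute)
      qed (use ij in \<open>simp add: insert_commute\<close>)
      then have uj0: "{u, j0} \<in> E" by (simp add: insert_commute)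
      have uv: "{u, v} \<in> E"
      proof (cases "j0 = v")
        case False
        then show ?thesis using rowI[of u v j0] uj0 ij u(1) v ne[of u j0] ne[of u v] by simp
      qed (use uj0 in simp)
      then have vu: "{v, u} \<in> E" by (simp add: insert_commute)
      have uI: "{a, u} \<in> E" if "a \<in> I" "a \<noteq> u" for a
        using rowI[of u a v] that u(1) v(1) uv less[of a v] ne[of u v] by (simp add: insert_commute)
      have cliqueI_less: "{i, a} \<in> E" if "i \<in> I" "a \<in> I" "a < i" for i a
      proof (cases "i = u")
        case True
        then show ?thesis using uI[of a] that by (simp add: insert_commute)
      next
        case False
        then have "a \<noteq> u" using that u(2)[of i] by auto
        then have "{a, i} \<in> E" using rowI[of a i u] uI[of a] u(1) u(2)[of i] that False by simp
        then show ?thesis by (simp add: insert_commute)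
      qed
      have cliqueI: "{i, a} \<in> E" if "i \<in> I" "a \<in> I" "i \<noteq> a" for i a
        using cliqueI_less[of i a] cliqueI_less[of a i] that
        by (cases "a < i") (simp_all add: insert_commute)
      have vJ: "{b, v} \<in> E" if "b \<in> J" "b \<noteq> v" for b
        using rowJ[of v u b] that u(1) v(1) vu less[of u b] ne[of u v] by (simp add: insert_commute)
      have cliqueJ_less: "{j, b} \<in> E" if "j \<in> J" "b \<in> J" "j < b" for j b
      proof (cases "j = v")
        case True
        then show ?thesis using vJ[of b] that by (simp add: insert_commute)
      next
        case False
        then have "b \<noteq> v" using that v(2)[of j] by auto
        then have "{b, j} \<in> E" using rowJ[of b v j] vJ[of b] v(1) v(2)[of j] that False by simp
        then show ?thesis by (simp add: insert_commute)
      qed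
      have cliqueJ: "{j, b} \<in> E" if "j \<in> J" "b \<in> J" "j \<noteq> b" for j b
        using cliqueJ_less[of j b] cliqueJ_less[of b j] that
        by (cases "j < b") (simp_all add: insert_commute)
      \<comment> \<open>A row of \<open>I\<close> contains the rest of the clique \<open>I\<close>
        and then an initial part of \<open>J\<close>; a row of \<open>J\<close>, without
        \<open>pairs J\<close>, is a final part of \<open>I\<close>. Both are closed downwards for
        \<open>key\<close>.\<close>
      have "E - pairs J \<in> ?M"
        unfolding threshold_graphs_def
      proof (intro CollectI conjI ballI impI)
        show "E - pairs J \<subseteq> pairs (I \<union> J)" using sub by auto
        fix x a b assume V: "x \<in> I \<union> J" "a \<in> I \<union> J" "b \<in> I \<union> J" and xab: "x \<noteq> a" "x \<noteq> b"
          and k: "key a < key b" and e: "{x, b} \<in> E - pairs J"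
        show "{x, a} \<in> E - pairs J"
        proof (cases "x \<in> I")
          case xI: True
          then have nJ: "x \<notin> J" using disj by auto
          show ?thesis
          proof (cases "a \<in> I")
            case True
            then show ?thesis using cliqueI[OF xI True] xab nJ by auto
          next
            case False
            then have "a < b" using k V unfolding key_def by (auto split: if_splits)
            then show ?thesis using rowI[of x a b] xI V xab e nJ by auto
          qed
        next
          case False
          then have xJ: "x \<in> J" using V by auto
          then have "b \<in> I" using e xab V by auto
          then have "a \<in> I" "b < a" using k unfolding key_def by (auto split: if_splits)
          then show ?thesis using rowJ[of x b a] xJ V xab e disj by auto
        qed
      qed
      moreover have "E = (E - pairs J) \<union> pairs J"
        using cliqueJ by (auto elim!: pairsE)
      ultimately show ?thesis by blast
    qed
  qed
  then have "card (bipolar_graphs I J) \<le>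
      card ((\<lambda>(E, E'). E \<union> E') ` ?T \<union> (\<lambda>E. E \<union> pairs J) ` ?M)"
    using fin by (intro card_mono) (auto simp: finite_threshold_graphs)
  also have "\<dots> \<le> card ?T + card ?M"
    using fin by (intro order.trans[OF card_Un_le] add_mono card_image_le)
      (auto simp: finite_threshold_graphs)
  also have "\<dots> \<le> 2 ^ card I * 2 ^ card J + 2 ^ (card I + card J)"
  proof (rule add_mono)
    show "card ?T \<le> 2 ^ card I * 2 ^ card J"
      unfolding card_cartesian_product using fin
      by (intro mult_le_mono card_threshold_graphs_le) (auto simp: inj_on_def)
    have "inj_on key (I \<union> J)" unfolding key_def inj_on_def by auto
    then have "card ?M \<le> 2 ^ card (I \<union> J)" using fin by (intro card_threshold_graphs_le) auto
    then show "card ?M \<le> 2 ^ (card I + card J)" using card_Un_disjoint[OF fin disj] by simp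
  qed
  finally show ?thesis by (simp add: power_add)
qed

section \<open>Rows with at most one change\<close>

definition one_change_on :: "nat set \<Rightarrow> nat set \<Rightarrow> bool" where
  "one_change_on B S \<longleftrightarrow> (\<forall>a\<in>B. \<forall>b\<in>B. \<forall>c\<in>B. a < b \<longrightarrow> b < c \<longrightarrow> (a \<in> S \<longleftrightarrow> c \<in> S) \<longrightarrow> (b \<in> S \<longleftrightarrow> a \<in> S))"

lemma one_change_onD:
  "one_change_on B S \<Longrightarrow> a \<in> B \<Longrightarrow> b \<in> B \<Longrightarrow> c \<in> B \<Longrightarrow> a < b \<Longrightarrow> b < c \<Longrightarrow>
    (a \<in> S \<longleftrightarrow> c \<in> S) \<Longrightarrow> (b \<in> S \<longleftrightarrow> a \<in> S)"
  unfolding one_change_on_def by blast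

lemma one_change_initial_segment:
  assumes "B \<subseteq> {..n}" "one_change_on B S" "m \<in> B" "\<And>b. b \<in> B \<Longrightarrow> m \<le> b" "m \<in> S"
  obtains t where "t \<le> Suc n" "B \<inter> S = B \<inter> {..<t}"
proof (cases "B \<subseteq> S")
  case True
  have "B \<inter> S = B \<inter> {..<Suc n}" using True assms(1) by (auto simp: less_Suc_eq_le)
  then show ?thesis using that[of "Suc n"] by simp
next
  case False
  define t where "t = (LEAST t. t \<in> B - S)"
  have "\<exists>t. t \<in> B - S" using False by auto
  then have t: "t \<in> B - S" unfolding t_def by (rule LeastI_ex)
  have less: "b \<in> S" if "b \<in> B" "b < t" for b
    using not_less_Least[of b "\<lambda>t. t \<in> B - S"] that unfolding t_def by auto
  have greater: "b \<notin> S" if "b \<in> B" "\<not> b < t" for b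
  proof
    assume "b \<in> S"
    then have "t < b" "m < t" using that t assms(3-5) by (auto simp: order_less_le)
    then show False using one_change_onD[OF assms(2), of m t b] assms(3,5) that t \<open>b \<in> S\<close> by auto
  qed
  have "B \<inter> S = B \<inter> {..<t}" using less greater by auto
  then show ?thesis using that[of t] t assms(1) by auto
qed

text \<open>Complementing \<open>S\<close> reduces a row that starts outside \<open>S\<close> to one
  that starts inside. The value \<open>t = Suc n\<close> covers constant rows, so there are
  \<open>n + 2\<close> possible cuts.\<close>

lemma one_change_cut:
  assumes "B \<subseteq> {..n}" "one_change_on B S"
  obtains t where "t \<le> Suc n" "B \<inter> S = B \<inter> {..<t} \<or> B \<inter> S = B \<inter> {t..}"
proof (cases "B = {}")
  case True
  then show ?thesis using that[of 0] by auto
next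
  case False
  have "finite B" using assms(1) finite_subset by blast
  then have m: "Min B \<in> B" "\<And>b. b \<in> B \<Longrightarrow> Min B \<le> b" using False by auto
  show ?thesis
  proof (cases "Min B \<in> S")
    case True
    obtain t where "t \<le> Suc n" "B \<inter> S = B \<inter> {..<t}"
      using one_change_initial_segment[OF assms m True] by blast
    then show ?thesis using that by blast
  next
    case False
    have "one_change_on B (- S)" using assms(2) unfolding one_change_on_def by simp
    then obtain t where t: "t \<le> Suc n" "B \<inter> - S = B \<inter> {..<t}"
      using one_change_initial_segment[OF assms(1) _ m] False by (metis ComplI)
    have "B \<inter> S = B - (B \<inter> - S)" by blast
    also have "\<dots> = B \<inter> {t..}" unfolding t(2) by auto
    finally have "B \<inter> S = B \<inter> {t..}" .
    then show ?thesis using that t by blast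
  qed
qed

definition neighbours :: "nat set set \<Rightarrow> nat set \<Rightarrow> nat \<Rightarrow> nat set" where
  "neighbours E A x = {y \<in> A - {x}. {x, y} \<in> E}"

definition one_change_graphs :: "nat set \<Rightarrow> nat set set set" where
  "one_change_graphs A = {E. E \<subseteq> pairs A \<and> (\<forall>x\<in>A. one_change_on (A - {x}) (neighbours E A x))}"

lemma one_change_graphsD:
  assumes "E \<in> one_change_graphs A" "x \<in> A" "a \<in> A" "b \<in> A" "c \<in> A" "x \<noteq> a" "x \<noteq> b" "x \<noteq> c"
    "a < b" "b < c" "{x, a} \<in> E \<longleftrightarrow> {x, c} \<in> E"
  shows "{x, b} \<in> E \<longleftrightarrow> {x, a} \<in> E"
proof -
  have "one_change_on (A - {x}) (neighbours E A x)"
    using assms unfolding one_change_graphs_def by auto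
  from one_change_onD[OF this, of a b c] show ?thesis using assms unfolding neighbours_def by auto
qed

lemma finite_one_change_graphs: "finite A \<Longrightarrow> finite (one_change_graphs A)"
  unfolding one_change_graphs_def by (rule finite_subset[of _ "Pow (pairs A)"]) auto

text \<open>Once the rows of the least and the greatest vertex are fixed, every other row is constant,
  decreasing (\<open>I\<close>) or increasing (\<open>J\<close>), and \<open>I\<close>, \<open>J\<close> are separated because the row of the
  least vertex changes only once.\<close>

lemma card_one_change_graphs_fixed_ends:
  assumes "finite A" and lo: "lo \<in> A" "\<And>w. w \<in> A \<Longrightarrow> w \<noteq> lo \<Longrightarrow> lo < w"
    and hi: "hi \<in> A" "\<And>w. w \<in> A \<Longrightarrow> w \<noteq> hi \<Longrightarrow> w < hi" and "lo \<noteq> hi"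
  shows "card {E \<in> one_change_graphs A. neighbours E A lo = P \<and> neighbours E A hi = Q} \<le> 2 * 2 ^ card A"
    (is "card ?F \<le> _")
proof (cases "?F = {}")
  case False
  then obtain E0 where E0: "E0 \<in> ?F" by blast
  define V where "V = A - {lo, hi}"
  \<comment> \<open>\<open>P\<close> and \<open>Q\<close> record the signs of each row at
    \<open>lo\<close> and \<open>hi\<close>: rows of \<open>I\<close> go from + to -, rows of
    \<open>J\<close> from - to +.\<close>
  define I where "I = {x \<in> V. x \<in> P \<and> x \<notin> Q}"
  define J where "J = {x \<in> V. x \<notin> P \<and> x \<in> Q}"
  have VA: "x \<in> A" "x \<noteq> lo" "x \<noteq> hi" "lo < x" "x < hi" if "x \<in> V" for x
    using that lo hi unfolding V_def by auto
  have IV: "x \<in> V" "x \<in> P" "x \<notin> Q" if "x \<in> I" for x using that unfolding I_def by auto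
  have JV: "x \<in> V" "x \<notin> P" "x \<in> Q" if "x \<in> J" for x using that unfolding J_def by auto
  have disj: "I \<inter> J = {}" unfolding I_def J_def by auto
  have finIJ: "finite I" "finite J" using assms(1) unfolding I_def J_def V_def by auto
  have "card I + card J = card (I \<union> J)" using card_Un_disjoint[OF finIJ disj] by simp
  also have "\<dots> \<le> card A" using assms(1) by (intro card_mono) (auto simp: I_def J_def V_def)
  finally have cardIJ: "card I + card J \<le> card A" .
  have elo: "{x, lo} \<in> E \<longleftrightarrow> x \<in> P" "{lo, x} \<in> E \<longleftrightarrow> x \<in> P" if "E \<in> ?F" "x \<in> A" "x \<noteq> lo" for E x
    using that unfolding neighbours_def by (auto simp: insert_commute)
  have ehi: "{x, hi} \<in> E \<longleftrightarrow> x \<in> Q" "{hi, x} \<in> E \<longleftrightarrow> x \<in> Q" if "E \<in> ?F" "x \<in> A" "x \<noteq> hi" for E x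
    using that unfolding neighbours_def by (auto simp: insert_commute)
  have const: "{x, y} \<in> E \<longleftrightarrow> x \<in> P" if E: "E \<in> ?F" and x: "x \<in> V" "x \<notin> I \<union> J" and y: "y \<in> A" "y \<noteq> x" for E x y
  proof -
    have PQ: "x \<in> P \<longleftrightarrow> x \<in> Q" using x unfolding I_def J_def by auto
    consider "y = lo" | "y = hi" | "y \<noteq> lo" "y \<noteq> hi" by blast
    then show ?thesis
    proof cases
      case 3
      then show ?thesis
        using one_change_graphsD[of E A x lo y hi] E elo(1)[OF E, of x] ehi(1)[OF E, of x] VA[OF x(1)] y lo hi PQ
        by auto
    qed (use elo(1)[OF E, of x] ehi(1)[OF E, of x] VA[OF x(1)] PQ in auto)
  qed
  \<comment> \<open>Edges at \<open>lo\<close> or \<open>hi\<close> are fixed by \<open>P\<close>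
    and \<open>Q\<close>, and edges at a constant row by \<open>const\<close>; a graph is therefore
    recovered from its edges inside \<open>I \<union> J\<close>.\<close>
  define r where "r = (\<lambda>E :: nat set set. E \<inter> pairs (I \<union> J))"
  have inj: "inj_on r ?F"
  proof (rule inj_onI)
    fix E E' assume E: "E \<in> ?F" and E': "E' \<in> ?F" and eq: "r E = r E'"
    show "E = E'"
    proof (rule edge_sets_eqI)
      show "E \<subseteq> pairs A" "E' \<subseteq> pairs A" using E E' unfolding one_change_graphs_def by auto
      fix x y assume xy: "x \<in> A" "y \<in> A" "x \<noteq> y"
      show "{x, y} \<in> E \<longleftrightarrow> {x, y} \<in> E'"
      proof (cases "x \<in> {lo, hi} \<or> y \<in> {lo, hi}")
        case True
        then consider "x = lo" | "x = hi" | "y = lo" | "y = hi" by auto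
        then show ?thesis
        proof cases
          case 1
          then show ?thesis using elo(2)[OF E, of y] elo(2)[OF E', of y] xy by simp
        next
          case 2
          then show ?thesis using ehi(2)[OF E, of y] ehi(2)[OF E', of y] xy by simp
        next
          case 3
          then show ?thesis using elo(1)[OF E, of x] elo(1)[OF E', of x] xy by simp
        next
          case 4
          then show ?thesis using ehi(1)[OF E, of x] ehi(1)[OF E', of x] xy by simp
        qed
      next
        case False
        then have V: "x \<in> V" "y \<in> V" using xy unfolding V_def by auto
        consider "x \<notin> I \<union> J" | "y \<notin> I \<union> J" | "x \<in> I \<union> J" "y \<in> I \<union> J" by blast
        then show ?thesis
        proof cases
          case 1
          then show ?thesis using const[OF E V(1) 1, of y] const[OF E' V(1) 1, of y] xy by auto
        next
          case 2
          then show ?thesis using const[OF E V(2) 2, of x] const[OF E' V(2) 2, of x] xy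
            by (auto simp: insert_commute)
        next
          case 3
          then have "{x, y} \<in> pairs (I \<union> J)" using xy by simp
          then show ?thesis using eq unfolding r_def by blast
        qed
      qed
    qed
  qed
  have low: "{x, a} \<in> E \<longleftrightarrow> {x, b} \<in> E"
    if "E \<in> ?F" "x \<in> V" "a \<in> V" "b \<in> V" "x \<noteq> a" "x \<noteq> b" "a < b" "{x, b} \<in> E \<longleftrightarrow> x \<in> P" for E x a b
  proof -
    have "{x, lo} \<in> E \<longleftrightarrow> x \<in> P" "E \<in> one_change_graphs A"
      using elo(1)[OF that(1), of x] VA[OF that(2)] that(1) by auto
    then show ?thesis
      using one_change_graphsD[of E A x lo a b] that(5-8) VA[OF that(2)] VA[OF that(3)] VA[OF that(4)] lo(1)
      by simp
  qed
  have high: "{x, b} \<in> E \<longleftrightarrow> {x, a} \<in> E"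
    if "E \<in> ?F" "x \<in> V" "a \<in> V" "b \<in> V" "x \<noteq> a" "x \<noteq> b" "a < b" "{x, a} \<in> E \<longleftrightarrow> x \<in> Q" for E x a b
  proof -
    have "{x, hi} \<in> E \<longleftrightarrow> x \<in> Q" "E \<in> one_change_graphs A"
      using ehi(1)[OF that(1), of x] VA[OF that(2)] that(1) by auto
    then show ?thesis
      using one_change_graphsD[of E A x a b hi] that(5-8) VA[OF that(2)] VA[OF that(3)] VA[OF that(4)] hi(1)
      by simp
  qed
  \<comment> \<open>\<open>P\<close> is the row of \<open>lo\<close> in the actual graph
    \<open>E0\<close>, so it changes at most once. As \<open>I\<close> lies inside \<open>P\<close>
    and \<open>J\<close> outside, interleaving them would take two changes; this gives
    \<open>sep\<close>.\<close>
  have P1: "y \<in> P \<longleftrightarrow> x \<in> P" if "x \<in> V" "y \<in> V" "z \<in> V" "x < y" "y < z" "x \<in> P \<longleftrightarrow> z \<in> P" for x y z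
  proof -
    have "E0 \<in> one_change_graphs A" using E0 by simp
    moreover have "{lo, w} \<in> E0 \<longleftrightarrow> w \<in> P" if "w \<in> V" for w using elo(2)[OF E0, of w] VA[OF that] by simp
    ultimately show ?thesis
      using one_change_graphsD[of E0 A lo x y z] that VA[OF that(1)] VA[OF that(2)] VA[OF that(3)] lo(1) by simp
  qed
  have IJV: "x \<in> V" if "x \<in> I \<union> J" for x using that IV(1) JV(1) by auto
  have sep: "(\<forall>i\<in>I. \<forall>j\<in>J. i < j) \<or> (\<forall>j\<in>J. \<forall>i\<in>I. j < i)"
  proof (rule ccontr)
    assume "\<not> ?thesis"
    then obtain i j i' j' where *: "i \<in> I" "j \<in> J" "\<not> i < j" "i' \<in> I" "j' \<in> J" "\<not> j' < i'" by blast
    have ne: "a \<noteq> b" if "a \<in> I" "b \<in> J" for a b using disj that by auto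
    have "j < i" "i' < j'" "i \<noteq> j'" using * ne[of i j] ne[of i' j'] ne[of i j'] by auto
    then show False
      using P1[of j i j'] P1[of i' j' i] * IV[of i] IV[of i'] JV[of j] JV[of j'] by (cases "i < j'") auto
  qed
  show ?thesis
  proof (cases "\<forall>i\<in>I. \<forall>j\<in>J. i < j")
    case True
    have "r ` ?F \<subseteq> bipolar_graphs I J"
    proof
      fix R assume "R \<in> r ` ?F"
      then obtain E where E: "E \<in> ?F" "R = r E" by blast
      show "R \<in> bipolar_graphs I J"
        unfolding bipolar_graphs_def E(2) r_def
      proof (intro CollectI conjI ballI impI)
        fix x a b assume "x \<in> I" "a \<in> I \<union> J" "b \<in> I \<union> J" "x \<noteq> a" "x \<noteq> b" "a < b"
          "{x, b} \<in> E \<inter> pairs (I \<union> J)"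
        then show "{x, a} \<in> E \<inter> pairs (I \<union> J)"
          using low[OF E(1), of x a b] IV[of x] IJV[of a] IJV[of b] by simp
      next
        fix x a b assume "x \<in> J" "a \<in> I \<union> J" "b \<in> I \<union> J" "x \<noteq> a" "x \<noteq> b" "a < b"
          "{x, a} \<in> E \<inter> pairs (I \<union> J)"
        then show "{x, b} \<in> E \<inter> pairs (I \<union> J)"
          using high[OF E(1), of x a b] JV[of x] IJV[of a] IJV[of b] by simp
      qed simp
    qed
    then have "card ?F \<le> card (bipolar_graphs I J)"
      using card_inj_on_le[OF inj] finite_bipolar_graphs[OF finIJ] by blast
    also have "\<dots> \<le> 2 * 2 ^ (card I + card J)" using card_bipolar_graphs_le[OF finIJ] True by blast
    also have "\<dots> \<le> 2 * 2 ^ card A" using cardIJ by (intro mult_le_mono power_increasing) auto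
    finally show ?thesis .
  next
    case False
    then have less: "\<And>j i. j \<in> J \<Longrightarrow> i \<in> I \<Longrightarrow> j < i" using sep by blast
    \<comment> \<open>With \<open>J\<close> below \<open>I\<close> the complementary graph is taken:
      its rows in \<open>J\<close> are closed downwards and its rows in \<open>I\<close>
      upwards.\<close>
    define r' where "r' = (\<lambda>E. pairs (I \<union> J) - r E)"
    have inj': "inj_on r' ?F"
    proof (rule inj_onI)
      fix E E' assume "E \<in> ?F" "E' \<in> ?F" "r' E = r' E'"
      moreover from this have "r E = r E'" unfolding r'_def r_def by blast
      ultimately show "E = E'" using inj by (simp add: inj_on_eq_iff)
    qed
    have "r' ` ?F \<subseteq> bipolar_graphs J I"
    proof
      fix R assume "R \<in> r' ` ?F"
      then obtain E where E: "E \<in> ?F" "R = r' E" by blast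
      show "R \<in> bipolar_graphs J I"
        unfolding bipolar_graphs_def E(2) r_def r'_def
      proof (intro CollectI conjI ballI impI)
        fix x a b assume "x \<in> J" "a \<in> J \<union> I" "b \<in> J \<union> I" "x \<noteq> a" "x \<noteq> b" "a < b"
          "{x, b} \<in> pairs (I \<union> J) - E \<inter> pairs (I \<union> J)"
        then show "{x, a} \<in> pairs (I \<union> J) - E \<inter> pairs (I \<union> J)"
          using low[OF E(1), of x a b] JV[of x] IJV[of a] IJV[of b] by auto
      next
        fix x a b assume "x \<in> I" "a \<in> J \<union> I" "b \<in> J \<union> I" "x \<noteq> a" "x \<noteq> b" "a < b"
          "{x, a} \<in> pairs (I \<union> J) - E \<inter> pairs (I \<union> J)"
        then show "{x, b} \<in> pairs (I \<union> J) - E \<inter> pairs (I \<union> J)"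
          using high[OF E(1), of x a b] IV[of x] IJV[of a] IJV[of b] by auto
      qed (auto simp: Un_commute)
    qed
    then have "card ?F \<le> card (bipolar_graphs J I)"
      using card_inj_on_le[OF inj'] finite_bipolar_graphs[OF finIJ(2,1)] by blast
    also have "\<dots> \<le> 2 * 2 ^ (card J + card I)" using card_bipolar_graphs_le[OF finIJ(2,1)] less by blast
    also have "\<dots> \<le> 2 * 2 ^ card A" using cardIJ by (intro mult_le_mono power_increasing) auto
    finally show ?thesis .
  qed
qed (simp only: card.empty)

text \<open>With at least two vertices, each of the two end rows has at most
  \<open>2 * (n + 2)\<close> possibilities, one per cut and direction, and fixing both leaves at
  most \<open>2 * 2 ^ card A\<close> graphs. The bound is the product of these three
  numbers.\<close>

lemma card_one_change_graphs_le:
  assumes "A \<subseteq> {1..n}"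
  shows "card (one_change_graphs A) \<le> 8 * (n + 2)\<^sup>2 * 2 ^ card A"
proof (cases "card A \<le> 1")
  case True
  have fin: "finite A" using assms finite_subset by blast
  then have "x = y" if "x \<in> A" "y \<in> A" for x y using that True card_le_Suc0_iff_eq[of A] by auto
  then have "one_change_graphs A \<subseteq> {{}}" unfolding one_change_graphs_def pairs_def by auto
  then have "card (one_change_graphs A) \<le> card {{} :: nat set set}" by (intro card_mono) auto
  also have "\<dots> \<le> 8 * (n + 2)\<^sup>2 * 2 ^ card A" by simp
  finally show ?thesis .
next
  case False
  have fin: "finite A" using assms finite_subset by blast
  define lo where "lo = Min A"
  define hi where "hi = Max A"
  have "A \<noteq> {}" using False by auto
  then have lo: "lo \<in> A" "\<And>w. w \<in> A \<Longrightarrow> w \<noteq> lo \<Longrightarrow> lo < w"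
    and hi: "hi \<in> A" "\<And>w. w \<in> A \<Longrightarrow> w \<noteq> hi \<Longrightarrow> w < hi"
    using fin unfolding lo_def hi_def by (auto simp: order_less_le)
  have ne: "lo \<noteq> hi"
  proof
    assume "lo = hi"
    then have "A \<subseteq> {lo}" using lo(2) hi(2) by fastforce
    then show False using False card_mono[of "{lo}" A] by simp
  qed
  define cuts where "cuts = (\<lambda>x. (\<lambda>t. (A - {x}) \<inter> {..<t}) ` {..Suc n} \<union> (\<lambda>t. (A - {x}) \<inter> {t..}) ` {..Suc n})"
  have fin_cuts: "finite (cuts x)" for x unfolding cuts_def by auto
  have card_cuts: "card (cuts x) \<le> 2 * (n + 2)" for x
  proof -
    have "card (cuts x) \<le> card {..Suc n} + card {..Suc n}"
      unfolding cuts_def by (intro order.trans[OF card_Un_le] add_mono card_image_le) auto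
    then show ?thesis by simp
  qed
  have nb: "neighbours E A x \<in> cuts x" if "E \<in> one_change_graphs A" "x \<in> A" for E x
  proof -
    have oc: "one_change_on (A - {x}) (neighbours E A x)" using that unfolding one_change_graphs_def by auto
    have "A - {x} \<subseteq> {..n}" using assms by auto
    from one_change_cut[OF this oc] obtain t where "t \<le> Suc n"
      "(A - {x}) \<inter> neighbours E A x = (A - {x}) \<inter> {..<t} \<or> (A - {x}) \<inter> neighbours E A x = (A - {x}) \<inter> {t..}" .
    moreover have "(A - {x}) \<inter> neighbours E A x = neighbours E A x" unfolding neighbours_def by auto
    ultimately show ?thesis unfolding cuts_def by auto
  qed
  let ?F = "\<lambda>(P, Q). {E \<in> one_change_graphs A. neighbours E A lo = P \<and> neighbours E A hi = Q}"
  have "one_change_graphs A \<subseteq> (\<Union>PQ\<in>cuts lo \<times> cuts hi. ?F PQ)" using nb lo(1) hi(1) by auto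
  then have "card (one_change_graphs A) \<le> card (\<Union>PQ\<in>cuts lo \<times> cuts hi. ?F PQ)"
    by (intro card_mono finite_UN_I finite_cartesian_product fin_cuts) (auto simp: finite_one_change_graphs fin)
  also have "\<dots> \<le> (\<Sum>PQ\<in>cuts lo \<times> cuts hi. card (?F PQ))"
    by (intro card_UN_le finite_cartesian_product fin_cuts)
  also have "\<dots> \<le> (\<Sum>PQ\<in>cuts lo \<times> cuts hi. 2 * 2 ^ card A)"
    using card_one_change_graphs_fixed_ends[OF fin lo hi ne] by (intro sum_mono) auto
  also have "\<dots> = card (cuts lo) * card (cuts hi) * (2 * 2 ^ card A)" by (simp add: card_cartesian_product)
  also have "\<dots> \<le> (2 * (n + 2)) * (2 * (n + 2)) * (2 * 2 ^ card A)"
    by (intro mult_le_mono card_cuts order.refl)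
  also have "\<dots> = 8 * (n + 2)\<^sup>2 * 2 ^ card A" by (simp add: power2_eq_square algebra_simps)
  finally show ?thesis .
qed

section \<open>Upper bound\<close>

lemma distinct_rank:
  assumes "distinct xs"
  obtains r :: "'a \<Rightarrow> nat" where "sorted_wrt (\<lambda>x y. r x < r y) xs"
proof
  have inj: "inj_on ((!) xs) {..<length xs}" using assms by (simp add: inj_on_nth)
  show "sorted_wrt (\<lambda>x y. the_inv_into {..<length xs} ((!) xs) x < the_inv_into {..<length xs} ((!) xs) y) xs"
    unfolding sorted_wrt_iff_nth_less by (auto simp: the_inv_into_f_f[OF inj])
qed

lemma rank_less_if_sorted_filter:
  fixes r :: "'a \<Rightarrow> nat"
  assumes r: "sorted_wrt (\<lambda>x y. r x < r y) xs" and R: "sorted_wrt R (filter P xs)"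
    and asym: "\<And>x y. R x y \<Longrightarrow> \<not> R y x"
    and xy: "x \<in> set xs" "y \<in> set xs" "P x" "P y" "R x y"
  shows "r x < r y"
proof -
  let ?ys = "filter P xs"
  have r': "sorted_wrt (\<lambda>x y. r x < r y) ?ys" using r by (rule sorted_wrt_filter)
  obtain i j where ij: "i < length ?ys" "j < length ?ys" "?ys ! i = x" "?ys ! j = y"
    using xy by (metis (mono_tags, lifting) in_set_conv_nth mem_Collect_eq set_filter)
  have "\<not> j < i" using sorted_wrt_nth_less[OF R, of j i] ij asym xy(5) by auto
  moreover have "i \<noteq> j" using ij asym xy(5) by auto
  ultimately show ?thesis using sorted_wrt_nth_less[OF r', of i j] ij by auto
qed

text \<open>If the middle sign differed from two equal outer ones, the three \<open>k\<close>-sets that contain \<open>Y\<close>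
  and two of \<open>a\<close>, \<open>b\<close>, \<open>c\<close> would form a cycle.\<close>

lemma lex_faces_one_change:
  assumes \<rho>: "\<rho> \<in> coadmissible_orders n k" and k: "k \<ge> 2" and Y: "Y \<in> ksubsets n (k - 2)"
    and abc: "a \<in> {1..n} - Y" "b \<in> {1..n} - Y" "c \<in> {1..n} - Y" "a < b" "b < c"
    and eq: "insert a Y \<in> lex_faces n k \<rho> \<longleftrightarrow> insert c Y \<in> lex_faces n k \<rho>"
  shows "insert b Y \<in> lex_faces n k \<rho> \<longleftrightarrow> insert a Y \<in> lex_faces n k \<rho>"
proof -
  have \<rho>': "distinct \<rho>" "set \<rho> = ksubsets n k"
    using \<rho> unfolding coadmissible_orders_def total_orders_def by auto
  obtain r :: "nat set \<Rightarrow> nat" where r: "sorted_wrt (\<lambda>A B. r A < r B) \<rho>"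
    using distinct_rank[OF \<rho>'(1)] .
  have orient: "if insert x Y \<in> lex_faces n k \<rho>
      then r (insert i (insert x Y)) < r (insert j (insert x Y))
      else r (insert j (insert x Y)) < r (insert i (insert x Y))"
    if x: "x \<in> {1..n} - Y" and ij: "i \<in> {1..n} - Y" "j \<in> {1..n} - Y" "i \<noteq> x" "j \<noteq> x" "i < j" for x i j
  proof -
    let ?X = "insert x Y"
    have "?X \<in> ksubsets n (Suc (k - 2))" using insert_in_ksubsets[OF Y x] .
    also have "Suc (k - 2) = k - 1" using k by simp
    finally have X: "?X \<in> ksubsets n (k - 1)" .
    have cop: "insert i ?X \<in> copacket n ?X" "insert j ?X \<in> copacket n ?X"
      using ij unfolding copacket_def by auto
    have "copacket n ?X \<subseteq> set \<rho>" using copacket_subset_ksubsets[OF X] k \<rho>' by simp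
    with cop have mem: "insert i ?X \<in> set \<rho>" "insert j ?X \<in> set \<rho>" by auto
    have less: "lex_less (insert i ?X) (insert j ?X)"
      using lex_less_insert[of ?X i j] ksubsets_finite[OF X] ij by auto
    show ?thesis
    proof (cases "?X \<in> lex_faces n k \<rho>")
      case True
      then have "sorted_wrt lex_less (filter (\<lambda>Y. Y \<in> copacket n ?X) \<rho>)"
        unfolding lex_faces_def by simp
      from rank_less_if_sorted_filter[OF r this lex_less_asym mem cop less] True show ?thesis by simp
    next
      case False
      then have s: "sorted_wrt (\<lambda>A B. lex_less B A) (filter (\<lambda>Y. Y \<in> copacket n ?X) \<rho>)"
        using \<rho> X unfolding lex_faces_def coadmissible_orders_def by blast
      show ?thesis
        using False rank_less_if_sorted_filter[OF r s lex_less_asym mem(2,1) cop(2,1) less] by simp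
    qed
  qed
  \<comment> \<open>Write ab for \<open>Y\<close> with \<open>a\<close> and \<open>b\<close> added.
    The sign of \<open>a\<close> compares ab with ac, that of \<open>b\<close> compares ab with bc,
    that of \<open>c\<close> compares ac with bc. Signs + - + give ab < ac < bc < ab, and - + - the
    reverse cycle.\<close>
  show ?thesis
    using orient[of a b c] orient[of b a c] orient[of c a b] abc eq
    by (auto simp: insert_commute[of a b] insert_commute[of a c] insert_commute[of b c] split: if_splits)
qed

section \<open>Links of \<open>(k-3)\<close>-sets and the upper bound\<close>

definition elements_above :: "nat \<Rightarrow> nat set \<Rightarrow> nat set" where
  "elements_above n Z = {x \<in> {1..n}. \<forall>z\<in>Z. z < x}"

text \<open>Only edges above all of \<open>Z\<close> are kept, so that a \<open>(k-1)\<close>-set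
  shows up in exactly one link of a \<open>(k-3)\<close>-set, as the edge formed by its two largest
  elements.\<close>

definition link :: "nat \<Rightarrow> nat set set \<Rightarrow> nat set \<Rightarrow> nat set set" where
  "link n F Z = {e \<in> pairs (elements_above n Z). Z \<union> e \<in> F}"

lemma finite_elements_above [simp]: "finite (elements_above n Z)"
  unfolding elements_above_def by simp

text \<open>Row \<open>x\<close> of the link shows the signs along the copacket of the
  \<open>(k-2)\<close>-set \<open>insert x Z\<close>, restricted to elements above
  \<open>Z\<close>.\<close>

lemma link_lex_faces_one_change:
  assumes \<rho>: "\<rho> \<in> coadmissible_orders n k" and k: "k \<ge> 3" and Z: "Z \<in> ksubsets n (k - 3)"
  shows "link n (lex_faces n k \<rho>) Z \<in> one_change_graphs (elements_above n Z)"
  unfolding one_change_graphs_def one_change_on_def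
proof (intro CollectI conjI ballI impI)
  show "link n (lex_faces n k \<rho>) Z \<subseteq> pairs (elements_above n Z)" unfolding link_def by auto
  let ?N = "neighbours (link n (lex_faces n k \<rho>) Z) (elements_above n Z)"
  fix x a b c
  assume x: "x \<in> elements_above n Z" and abc: "a \<in> elements_above n Z - {x}" "b \<in> elements_above n Z - {x}" "c \<in> elements_above n Z - {x}"
    and less: "a < b" "b < c" and eq: "a \<in> ?N x \<longleftrightarrow> c \<in> ?N x"
  have "x \<in> {1..n} - Z" using x unfolding elements_above_def by auto
  from insert_in_ksubsets[OF Z this] have "insert x Z \<in> ksubsets n (Suc (k - 3))" .
  also have "Suc (k - 3) = k - 2" using k by simp
  finally have Y: "insert x Z \<in> ksubsets n (k - 2)" .
  have nb: "y \<in> ?N x \<longleftrightarrow> insert y (insert x Z) \<in> lex_faces n k \<rho>" if "y \<in> elements_above n Z - {x}" for y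
    using that x unfolding neighbours_def link_def by (auto simp: insert_commute)
  have mem: "y \<in> {1..n} - insert x Z" if "y \<in> elements_above n Z - {x}" for y
    using that unfolding elements_above_def by auto
  show "b \<in> ?N x \<longleftrightarrow> a \<in> ?N x"
    unfolding nb[OF abc(1)] nb[OF abc(2)]
  proof (rule lex_faces_one_change[OF \<rho> _ Y])
    show "insert a (insert x Z) \<in> lex_faces n k \<rho> \<longleftrightarrow> insert c (insert x Z) \<in> lex_faces n k \<rho>"
      using eq nb[OF abc(1)] nb[OF abc(3)] by simp
  qed (use mem[OF abc(1)] mem[OF abc(2)] mem[OF abc(3)] less k in simp_all)
qed

lemma two_largest_split:
  assumes "X \<in> ksubsets n m" "m \<ge> 2"
  obtains Z e where "Z \<in> ksubsets n (m - 2)" "e \<in> pairs (elements_above n Z)" "X = Z \<union> e"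
proof -
  have X: "X \<subseteq> {1..n}" "card X = m" "finite X"
    using assms(1) ksubsets_finite[OF assms(1)] unfolding ksubsets_def by auto
  define b where "b = Max X"
  have "X \<noteq> {}" using X assms(2) by auto
  then have b: "b \<in> X" "\<And>x. x \<in> X \<Longrightarrow> x \<le> b" using X unfolding b_def by auto
  define a where "a = Max (X - {b})"
  have "card (X - {b}) = m - 1" using X b by simp
  then have "X - {b} \<noteq> {}" using assms(2) by (intro notI) simp
  then have "Max (X - {b}) \<in> X - {b}" using X(3) by (intro Max_in) auto
  then have a: "a \<in> X - {b}" unfolding a_def .
  have a_max: "x \<le> a" if "x \<in> X - {b}" for x using that X(3) unfolding a_def by (intro Max_ge) auto
  show ?thesis
  proof (rule that)
    show "X - {a, b} \<in> ksubsets n (m - 2)"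
      using X a b unfolding ksubsets_def by (auto simp: card_Diff_subset)
    have "z < a" "z < b" if "z \<in> X - {a, b}" for z
      using a_max[of z] b(2)[of z] that by auto
    then show "{a, b} \<in> pairs (elements_above n (X - {a, b}))"
      using a b X(1) unfolding elements_above_def by auto
    show "X = (X - {a, b}) \<union> {a, b}" using a b by auto
  qed
qed

text \<open>A pair of \<open>Z\<close> and an element \<open>a\<close> above it is recovered from
  \<open>insert a Z\<close>, whose maximum is \<open>a\<close>.\<close>

lemma sum_card_elements_above_le: "(\<Sum>Z\<in>ksubsets n m. card (elements_above n Z)) \<le> n choose (Suc m)"
proof -
  have inj: "inj_on (\<lambda>(Z, a). insert a Z) (SIGMA Z:ksubsets n m. elements_above n Z)"
  proof (rule inj_onI, clarify)
    fix Z a Z' a'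
    assume Z: "Z \<in> ksubsets n m" "a \<in> elements_above n Z" "Z' \<in> ksubsets n m" "a' \<in> elements_above n Z'"
      and eq: "insert a Z = insert a' Z'"
    have lt: "\<And>z. z \<in> Z \<Longrightarrow> z < a" "\<And>z. z \<in> Z' \<Longrightarrow> z < a'" using Z unfolding elements_above_def by auto
    have "a' \<in> insert a Z" "a \<in> insert a' Z'" using eq by auto
    then have "a = a'" using lt(1)[of a'] lt(2)[of a] by auto
    moreover have "Z = insert a Z - {a}" "Z' = insert a' Z' - {a'}" using lt by auto
    ultimately show "Z = Z' \<and> a = a'" using eq by metis
  qed
  have "(\<Sum>Z\<in>ksubsets n m. card (elements_above n Z)) = card (SIGMA Z:ksubsets n m. elements_above n Z)" by simp
  also have "\<dots> \<le> card (ksubsets n (Suc m))"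
  proof (rule card_inj_on_le[OF inj])
    show "(\<lambda>(Z, a). insert a Z) ` (SIGMA Z:ksubsets n m. elements_above n Z) \<subseteq> ksubsets n (Suc m)"
    proof clarify
      fix Z a assume Z: "Z \<in> ksubsets n m" and "a \<in> elements_above n Z"
      then have "a \<in> {1..n} - Z" unfolding elements_above_def by auto
      then show "insert a Z \<in> ksubsets n (Suc m)" using insert_in_ksubsets[OF Z] by blast
    qed
  qed simp
  finally show ?thesis by (simp add: card_ksubsets)
qed

text \<open>A class is determined by the links of its face set at all \<open>(k-3)\<close>-sets, and
  each link is a one-change graph on the elements above \<open>Z\<close>. The graph bounds are
  multiplied over all \<open>Z\<close>.\<close>

lemma card_dual_higher_bruhat_le:
  assumes k: "k \<ge> 3"
  shows "card (dual_higher_bruhat n k) \<le> (8 * (n + 2)\<^sup>2) ^ (n choose (k - 3)) * 2 ^ (n choose (k - 2))"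
proof -
  let ?S = "lex_faces n k ` coadmissible_orders n k" and ?Zs = "ksubsets n (k - 3)"
  define \<Phi> where "\<Phi> = (\<lambda>F. \<lambda>Z\<in>?Zs. link n F Z)"
  have k1: "k - 1 \<ge> 2" using k by simp
  have inj: "inj_on \<Phi> ?S"
  proof (rule inj_onI)
    fix F F' assume FF: "F \<in> ?S" "F' \<in> ?S" and eq: "\<Phi> F = \<Phi> F'"
    have link_eq: "link n F Z = link n F' Z" if "Z \<in> ?Zs" for Z
      using fun_cong[OF eq, of Z] that unfolding \<Phi>_def by simp
    have "X \<in> F \<longleftrightarrow> X \<in> F'" if X: "X \<in> ksubsets n (k - 1)" for X
    proof -
      obtain Z e where "Z \<in> ksubsets n (k - 1 - 2)" "e \<in> pairs (elements_above n Z)" "X = Z \<union> e"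
        using two_largest_split[OF X k1] .
      moreover have "k - 1 - 2 = k - 3" by simp
      ultimately have "X \<in> F \<longleftrightarrow> e \<in> link n F Z" "X \<in> F' \<longleftrightarrow> e \<in> link n F' Z" "Z \<in> ?Zs"
        unfolding link_def by auto
      then show ?thesis using link_eq by simp
    qed
    moreover have "F \<subseteq> ksubsets n (k - 1)" "F' \<subseteq> ksubsets n (k - 1)" using FF unfolding lex_faces_def by auto
    ultimately show "F = F'" by blast
  qed
  have "card (dual_higher_bruhat n k) = card ?S" using card_dual_higher_bruhat k by simp
  also have "\<dots> \<le> card (\<Pi>\<^sub>E Z\<in>?Zs. one_change_graphs (elements_above n Z))"
  proof (rule card_inj_on_le[OF inj])
    show "\<Phi> ` ?S \<subseteq> (\<Pi>\<^sub>E Z\<in>?Zs. one_change_graphs (elements_above n Z))"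
      unfolding \<Phi>_def using link_lex_faces_one_change[OF _ k] by auto
    show "finite (\<Pi>\<^sub>E Z\<in>?Zs. one_change_graphs (elements_above n Z))"
      by (intro finite_PiE) (auto simp: finite_one_change_graphs)
  qed
  also have "\<dots> = (\<Prod>Z\<in>?Zs. card (one_change_graphs (elements_above n Z)))" by (simp add: card_PiE)
  also have "\<dots> \<le> (\<Prod>Z\<in>?Zs. 8 * (n + 2)\<^sup>2 * 2 ^ card (elements_above n Z))"
    by (intro prod_mono conjI card_one_change_graphs_le) (auto simp: elements_above_def)
  also have "\<dots> = (8 * (n + 2)\<^sup>2) ^ card ?Zs * 2 ^ (\<Sum>Z\<in>?Zs. card (elements_above n Z))"
    by (simp only: prod.distrib prod_constant power_sum power_mult_distrib)
  also have "\<dots> \<le> (8 * (n + 2)\<^sup>2) ^ (n choose (k - 3)) * 2 ^ (n choose (k - 2))"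
  proof (intro mult_le_mono power_increasing)
    have "Suc (k - 3) = k - 2" using k by simp
    then show "(\<Sum>Z\<in>?Zs. card (elements_above n Z)) \<le> n choose (k - 2)"
      using sum_card_elements_above_le[of n "k - 3"] by simp
  qed (auto simp: card_ksubsets)
  finally show ?thesis .
qed

section \<open>Lower bound\<close>

definition sum_level :: "nat \<Rightarrow> nat \<Rightarrow> nat \<Rightarrow> nat set set" where
  "sum_level n m s = {X \<in> ksubsets n m. \<Sum>X = s}"

lemma finite_sum_level [simp]: "finite (sum_level n m s)"
  unfolding sum_level_def by simp

text \<open>This is \<open>2 (s e\<^sub>1 - e\<^sub>2)\<close> for the elementary symmetric functions of \<open>Z\<close>. Adding an
  element to \<open>X\<close> changes it by an amount whose sign is that of \<open>s - \<Sum>X\<close>.\<close>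

definition potential :: "nat \<Rightarrow> nat set \<Rightarrow> int" where
  "potential s Z = 2 * int s * int (\<Sum>Z) - (int (\<Sum>Z))\<^sup>2 + (\<Sum>z\<in>Z. (int z)\<^sup>2)"

lemma potential_insert:
  assumes "finite X" "i \<notin> X"
  shows "potential s (insert i X) = potential s X + 2 * int i * (int s - int (\<Sum>X))"
  using assms unfolding potential_def by (simp add: algebra_simps power2_eq_square)

text \<open>Only the face \<open>Z - {i}\<close> with \<open>i = \<Sum>Z - s\<close> can have sum \<open>s\<close>, so the
  orientation of such a face can be chosen freely. If \<open>\<Sum>Z < s\<close>, truncation gives \<open>i = 0 \<notin> Z\<close>.\<close>

definition tie_break :: "nat \<Rightarrow> nat set set \<Rightarrow> nat set \<Rightarrow> int" where
  "tie_break s T Z =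
     (let i = \<Sum>Z - s in if i \<in> Z then (if Z - {i} \<in> T then int i else - int i) else 0)"

text \<open>Distinct potentials are integers and differ by at least 1, hence by at least
  \<open>2 * n + 1\<close> after scaling, while two tie-breaks differ by at most
  \<open>2 * n\<close>. The potential thus decides first.\<close>

definition sort_value :: "nat \<Rightarrow> nat \<Rightarrow> nat set set \<Rightarrow> nat set \<Rightarrow> int" where
  "sort_value n s T Z = potential s Z * (2 * int n + 1) + tie_break s T Z"

lemma abs_tie_break_le: "Z \<subseteq> {1..n} \<Longrightarrow> \<bar>tie_break s T Z\<bar> \<le> int n"
  unfolding tie_break_def Let_def by auto

lemma tie_break_insert:
  assumes "finite X" "i \<notin> X" "\<Sum>X = s"
  shows "tie_break s T (insert i X) = (if X \<in> T then int i else - int i)"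
proof -
  have "\<Sum>(insert i X) - s = i" "insert i X - {i} = X" using assms by auto
  then show ?thesis unfolding tie_break_def Let_def by simp
qed

lemma sort_value_less:
  assumes "potential s A < potential s B" "A \<subseteq> {1..n}" "B \<subseteq> {1..n}"
  shows "sort_value n s T A < sort_value n s T B"
proof -
  have "(potential s A + 1) * (2 * int n + 1) \<le> potential s B * (2 * int n + 1)"
    using assms(1) by (intro mult_right_mono) auto
  then have "potential s A * (2 * int n + 1) + (2 * int n + 1) \<le> potential s B * (2 * int n + 1)"
    by (simp add: algebra_simps)
  then show ?thesis
    using abs_tie_break_le[OF assms(2), of s T] abs_tie_break_le[OF assms(3), of s T]
    unfolding sort_value_def by linarith
qed

text \<open>Adding \<open>i\<close> changes the potential by \<open>2 * i * (s - \<Sum>X)\<close>,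
  which is strictly monotone in \<open>i\<close> unless \<open>X\<close> has sum \<open>s\<close>.
  In that case the potentials agree and the tie-break \<open>i\<close> or \<open>- i\<close>
  decides.\<close>

lemma sort_value_insert_less:
  assumes X: "X \<subseteq> {1..n}" and ij: "i \<in> {1..n} - X" "j \<in> {1..n} - X" "i < j"
  shows "if \<Sum>X < s \<or> (\<Sum>X = s \<and> X \<in> T)
    then sort_value n s T (insert i X) < sort_value n s T (insert j X)
    else sort_value n s T (insert j X) < sort_value n s T (insert i X)"
proof -
  have fin: "finite X" using X finite_subset by blast
  have sub: "insert i X \<subseteq> {1..n}" "insert j X \<subseteq> {1..n}" using X ij by auto
  have pot: "potential s (insert i X) = potential s X + 2 * int i * (int s - int (\<Sum>X))"
    "potential s (insert j X) = potential s X + 2 * int j * (int s - int (\<Sum>X))"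
    using potential_insert fin ij by auto
  consider "\<Sum>X < s" | "\<Sum>X > s" | "\<Sum>X = s" by linarith
  then show ?thesis
  proof cases
    case 1
    then have "2 * int i * (int s - int (\<Sum>X)) < 2 * int j * (int s - int (\<Sum>X))"
      using ij by (intro mult_strict_right_mono) (auto simp del: of_nat_sum)
    then have "potential s (insert i X) < potential s (insert j X)" using pot by linarith
    then show ?thesis using sort_value_less[OF _ sub] 1 by simp
  next
    case 2
    then have "2 * int j * (int s - int (\<Sum>X)) < 2 * int i * (int s - int (\<Sum>X))"
      using ij by (intro mult_strict_right_mono_neg) (auto simp del: of_nat_sum)
    then have "potential s (insert j X) < potential s (insert i X)" using pot by linarith
    then show ?thesis using sort_value_less[OF _ sub(2,1)] 2 by simp
  next
    case 3
    then have "potential s (insert i X) = potential s (insert j X)" using pot by simp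
    then show ?thesis
      using 3 ij tie_break_insert[OF fin, of i s T] tie_break_insert[OF fin, of j s T]
      unfolding sort_value_def by simp
  qed
qed

text \<open>Sorting by \<open>f\<close> only gives a weak order; strict monotonicity along the
  copacket rules out ties as well as wrong order.\<close>

lemma sorted_filter_copacket:
  fixes f :: "nat set \<Rightarrow> int"
  assumes "sorted_wrt (\<lambda>A B. f A \<le> f B) \<rho>" "distinct \<rho>" "finite X"
  shows "(\<And>i j. i \<in> {1..n} - X \<Longrightarrow> j \<in> {1..n} - X \<Longrightarrow> i < j \<Longrightarrow> f (insert i X) < f (insert j X)) \<Longrightarrow>
      sorted_wrt lex_less (filter (\<lambda>Y. Y \<in> copacket n X) \<rho>)"
    and "(\<And>i j. i \<in> {1..n} - X \<Longrightarrow> j \<in> {1..n} - X \<Longrightarrow> i < j \<Longrightarrow> f (insert j X) < f (insert i X)) \<Longrightarrow>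
      sorted_wrt (\<lambda>A B. lex_less B A) (filter (\<lambda>Y. Y \<in> copacket n X) \<rho>)"
proof -
  let ?ys = "filter (\<lambda>Y. Y \<in> copacket n X) \<rho>"
  have le: "f (?ys ! p) \<le> f (?ys ! q)" "?ys ! p \<noteq> ?ys ! q" if "p < q" "q < length ?ys" for p q
    using that sorted_wrt_nth_less[OF sorted_wrt_filter[OF assms(1)], of p q] assms(2)
    by (auto simp: nth_eq_iff_index_eq)
  have ins: "\<exists>i. i \<in> {1..n} - X \<and> ?ys ! p = insert i X" if "p < length ?ys" for p
    using nth_mem[OF that] unfolding copacket_def by auto
  show "sorted_wrt lex_less ?ys"
    if up: "\<And>i j. i \<in> {1..n} - X \<Longrightarrow> j \<in> {1..n} - X \<Longrightarrow> i < j \<Longrightarrow> f (insert i X) < f (insert j X)"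
    unfolding sorted_wrt_iff_nth_less
  proof (intro allI impI)
    fix p q assume pq: "p < q" "q < length ?ys"
    obtain i j where i: "i \<in> {1..n} - X" "?ys ! p = insert i X" and j: "j \<in> {1..n} - X" "?ys ! q = insert j X"
      using ins[of p] ins[of q] pq by auto
    have "\<not> j < i" "i \<noteq> j" using up[of j i] i j le[OF pq] by auto
    then show "lex_less (?ys ! p) (?ys ! q)" using lex_less_insert[OF assms(3), of i j] i j by auto
  qed
  show "sorted_wrt (\<lambda>A B. lex_less B A) ?ys"
    if down: "\<And>i j. i \<in> {1..n} - X \<Longrightarrow> j \<in> {1..n} - X \<Longrightarrow> i < j \<Longrightarrow> f (insert j X) < f (insert i X)"
    unfolding sorted_wrt_iff_nth_less
  proof (intro allI impI)
    fix p q assume pq: "p < q" "q < length ?ys"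
    obtain i j where i: "i \<in> {1..n} - X" "?ys ! p = insert i X" and j: "j \<in> {1..n} - X" "?ys ! q = insert j X"
      using ins[of p] ins[of q] pq by auto
    have "\<not> i < j" "i \<noteq> j" using down[of i j] i j le[OF pq] by auto
    then show "lex_less (?ys ! q) (?ys ! p)" using lex_less_insert[OF assms(3), of j i] i j by auto
  qed
qed

lemma card_copacket:
  assumes "X \<in> ksubsets n m"
  shows "card (copacket n X) = n - m"
proof -
  have "inj_on (\<lambda>i. insert i X) ({1..n} - X)" by (auto simp: inj_on_def)
  then have "card (copacket n X) = card ({1..n} - X)" unfolding copacket_def by (rule card_image)
  also have "\<dots> = n - m"
    using assms ksubsets_finite[OF assms] unfolding ksubsets_def by (simp add: card_Diff_subset)
  finally show ?thesis .
qed

lemma exists_order_with_level_faces: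
  assumes T: "T \<subseteq> sum_level n (k - 1) s" and k: "1 \<le> k" "k < n"
  shows "\<exists>\<rho>\<in>coadmissible_orders n k. lex_faces n k \<rho> \<inter> sum_level n (k - 1) s = T"
proof -
  obtain l where l: "set l = ksubsets n k" "distinct l"
    using finite_distinct_list[OF finite_ksubsets] by blast
  define \<rho> where "\<rho> = sort_key (sort_value n s T) l"
  have \<rho>: "set \<rho> = ksubsets n k" "distinct \<rho>" using l unfolding \<rho>_def by auto
  have srt: "sorted_wrt (\<lambda>A B. sort_value n s T A \<le> sort_value n s T B) \<rho>"
    using sorted_sort_key[of "sort_value n s T" l] unfolding \<rho>_def sorted_map .
  have up: "sorted_wrt lex_less (filter (\<lambda>Y. Y \<in> copacket n X) \<rho>)"
    if "X \<in> ksubsets n (k - 1)" "\<Sum>X < s \<or> (\<Sum>X = s \<and> X \<in> T)" for X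
    using sorted_filter_copacket(1)[OF srt \<rho>(2) ksubsets_finite[OF that(1)], of n]
      sort_value_insert_less[of X n _ _ s T] that unfolding ksubsets_def by simp
  have down: "sorted_wrt (\<lambda>A B. lex_less B A) (filter (\<lambda>Y. Y \<in> copacket n X) \<rho>)"
    if "X \<in> ksubsets n (k - 1)" "\<not> (\<Sum>X < s \<or> (\<Sum>X = s \<and> X \<in> T))" for X
    using sorted_filter_copacket(2)[OF srt \<rho>(2) ksubsets_finite[OF that(1)], of n]
      sort_value_insert_less[of X n _ _ s T] that unfolding ksubsets_def by simp
  have adm: "\<rho> \<in> coadmissible_orders n k"
    unfolding coadmissible_orders_def total_orders_def using \<rho> up down by blast
  have "X \<in> lex_faces n k \<rho> \<longleftrightarrow> X \<in> T" if X: "X \<in> sum_level n (k - 1) s" for X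
  proof
    assume "X \<in> T"
    then show "X \<in> lex_faces n k \<rho>" using up[of X] X unfolding lex_faces_def sum_level_def by simp
  next
    assume lex: "X \<in> lex_faces n k \<rho>"
    show "X \<in> T"
    proof (rule ccontr)
      assume "X \<notin> T"
      let ?ys = "filter (\<lambda>Y. Y \<in> copacket n X) \<rho>"
      have XX: "X \<in> ksubsets n (k - 1)" "\<Sum>X = s" using X unfolding sum_level_def by auto
      have s: "sorted_wrt lex_less ?ys" "sorted_wrt (\<lambda>A B. lex_less B A) ?ys"
        using lex down[of X] XX \<open>X \<notin> T\<close> unfolding lex_faces_def by auto
      have "copacket n X \<subseteq> set \<rho>" using copacket_subset_ksubsets[OF XX(1) k(1)] \<rho>(1) by simp
      then have "set ?ys = copacket n X" by auto
      then have "length ?ys = n - (k - 1)"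
        using distinct_card[of ?ys] \<rho>(2) card_copacket[OF XX(1)] by simp
      \<comment> \<open>Since \<open>k < n\<close>, the copacket has at least two elements and
        cannot be sorted both ways.\<close>
      then have "1 < length ?ys" using k by simp
      then show False
        using sorted_wrt_nth_less[OF s(1), of 0 1] sorted_wrt_nth_less[OF s(2), of 0 1] lex_less_asym
        by auto
    qed
  qed
  then have "lex_faces n k \<rho> \<inter> sum_level n (k - 1) s = T" using T by blast
  with adm show ?thesis by blast
qed

text \<open>Intersecting with the level maps the realised face sets onto all of its subsets.\<close>

lemma card_dual_higher_bruhat_ge:
  assumes "1 \<le> k" "k < n"
  shows "2 ^ card (sum_level n (k - 1) s) \<le> card (dual_higher_bruhat n k)"
proof -
  let ?L = "sum_level n (k - 1) s" and ?S = "lex_faces n k ` coadmissible_orders n k"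
  have "Pow ?L \<subseteq> (\<lambda>F. F \<inter> ?L) ` ?S"
  proof
    fix T assume "T \<in> Pow ?L"
    then obtain \<rho> where "\<rho> \<in> coadmissible_orders n k" "lex_faces n k \<rho> \<inter> ?L = T"
      using exists_order_with_level_faces[OF _ assms] by blast
    then show "T \<in> (\<lambda>F. F \<inter> ?L) ` ?S" by blast
  qed
  then have "card (Pow ?L) \<le> card ?S"
    by (rule surj_card_le[rotated]) (simp add: finite_coadmissible_orders)
  then show ?thesis using card_dual_higher_bruhat[OF assms(1)] by (simp add: card_Pow)
qed

section \<open>Counting the sets of a given sum by Eulerian numbers\<close>

definition cyclic_diff :: "nat \<Rightarrow> nat \<Rightarrow> nat \<Rightarrow> nat" where
  "cyclic_diff n p q = (if p \<le> q then q - p else q + n - p)"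

lemma cyclic_diff_less: "p < n \<Longrightarrow> q < n \<Longrightarrow> cyclic_diff n p q < n"
  unfolding cyclic_diff_def by auto

lemma cyclic_diff_inj: "p < n \<Longrightarrow> q < n \<Longrightarrow> q' < n \<Longrightarrow> cyclic_diff n p q = cyclic_diff n p q' \<Longrightarrow> q = q'"
  unfolding cyclic_diff_def by (auto split: if_splits)

text \<open>The differences telescope, except that each descent contributes an extra
  \<open>n\<close>. The first step starts at \<open>y 0 = 0\<close> and never wraps around.\<close>

lemma sum_cyclic_diff:
  assumes "y 0 = 0" "\<And>j. j \<le> t \<Longrightarrow> y j < n"
  shows "(\<Sum>j=1..t. cyclic_diff n (y (j - 1)) (y j)) = y t + n * card {i \<in> {1..<t}. y (Suc i) < y i}"
  using assms(2)
proof (induction t)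
  case (Suc t)
  show ?case
  proof (cases "t = 0")
    case True
    then show ?thesis using assms(1) by (simp add: cyclic_diff_def)
  next
    case False
    let ?D = "\<lambda>t. {i \<in> {1..<t}. y (Suc i) < y i}"
    have D: "?D (Suc t) = (if y (Suc t) < y t then insert t (?D t) else ?D t)"
      using False by (auto simp: less_Suc_eq)
    have "card (?D (Suc t)) = card (?D t) + (if y (Suc t) < y t then 1 else 0)" unfolding D by auto
    moreover have "cyclic_diff n (y t) (y (Suc t)) + y t = y (Suc t) + (if y (Suc t) < y t then n else 0)"
      using Suc.prems[of t] unfolding cyclic_diff_def by auto
    ultimately show ?thesis using Suc.IH Suc.prems by (auto simp: algebra_simps)
  qed
qed (simp add: assms)

text \<open>With \<open>m = k - 2\<close>, the \<open>m + 1\<close> coordinates will list the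
  elements of a \<open>(k-1)\<close>-set in any order.\<close>

definition sum_tuples :: "nat \<Rightarrow> nat \<Rightarrow> nat \<Rightarrow> (nat \<Rightarrow> nat) set" where
  "sum_tuples n m s = {x \<in> {0..m} \<rightarrow>\<^sub>E {1..n}. (\<Sum>j\<in>{0..m}. x j) = s}"

lemma finite_sum_tuples [simp]: "finite (sum_tuples n m s)"
  unfolding sum_tuples_def by (rule finite_subset[of _ "{0..m} \<rightarrow>\<^sub>E {1..n}"]) (auto intro: finite_PiE)

text \<open>A permutation with \<open>d\<close> descents and a set of values give a sequence \<open>y\<close> in \<open>{..<n}\<close> with
  \<open>d\<close> descents; its successive differences modulo \<open>n\<close> wrap around exactly at the descents, so
  they add up to \<open>y m + d * n\<close>. The coordinate \<open>n - y m\<close> is added to make the sum constant.\<close>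

lemma card_sum_tuples_ge:
  assumes "m \<ge> 1"
  shows "(n choose m) * eulerian m d \<le> card (sum_tuples n m ((d + 1) * n + m))"
proof -
  let ?Ss = "{S. S \<subseteq> {..<n} \<and> card S = m}"
  let ?Ps = "{\<pi>. \<pi> permutes {1..m} \<and> card {i \<in> {1..<m}. \<pi> (Suc i) < \<pi> i} = d}"
  define y where "y = (\<lambda>(S, \<pi> :: nat \<Rightarrow> nat) (j :: nat). if j = 0 then 0 else sorted_list_of_set S ! (\<pi> j - 1) :: nat)"
  \<comment> \<open>The \<open>Suc\<close> moves differences from \<open>{..<n}\<close> into
    \<open>{1..n}\<close>; over \<open>m\<close> coordinates it accounts for the summand
    \<open>m\<close> of the total.\<close>
  define x where "x = (\<lambda>p. \<lambda>j\<in>{0..m}. if j = 0 then n - y p m else Suc (cyclic_diff n (y p (j - 1)) (y p j)))"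
  have nth: "sorted_list_of_set S ! (a - 1) < sorted_list_of_set S ! (b - 1) \<longleftrightarrow> a < b"
    "sorted_list_of_set S ! (a - 1) \<in> S"
    if "S \<in> ?Ss" "a \<in> {1..m}" "b \<in> {1..m}" for S a b
  proof -
    let ?l = "sorted_list_of_set S"
    have fin: "finite S" using that finite_subset by blast
    have len: "length ?l = m" using that by simp
    have lt: "?l ! (a - 1) < ?l ! (b - 1)" if "a < b" "a \<in> {1..m}" "b \<in> {1..m}" for a b
      using sorted_wrt_nth_less[OF strict_sorted_list_of_set, of "a - 1" "b - 1" S] that len by auto
    show "?l ! (a - 1) < ?l ! (b - 1) \<longleftrightarrow> a < b"
      using lt[of a b] lt[of b a] that by (cases a b rule: linorder_cases) auto
    show "?l ! (a - 1) \<in> S"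
      using nth_mem[of "a - 1" ?l] that len fin by auto
  qed
  have range: "\<pi> j \<in> {1..m}" if "\<pi> \<in> ?Ps" "j \<in> {1..m}" for \<pi> j
    using that permutes_in_image[of \<pi> "{1..m}" j] by simp
  have y_less: "y (S, \<pi>) j < n" if "S \<in> ?Ss" "\<pi> \<in> ?Ps" "j \<le> m" for S \<pi> j
  proof (cases "j = 0")
    case True
    have "S \<noteq> {}" using that assms by auto
    then have "n > 0" using that by auto
    then show ?thesis using True unfolding y_def by simp
  next
    case False
    then have j: "j \<in> {1..m}" using that by auto
    have "y (S, \<pi>) j \<in> S" using nth(2)[OF that(1) range[OF that(2) j] range[OF that(2) j]] False unfolding y_def by simp
    then show ?thesis using that by auto
  qed
  have desc: "card {i \<in> {1..<m}. y (S, \<pi>) (Suc i) < y (S, \<pi>) i} = d" if S: "S \<in> ?Ss" and \<pi>: "\<pi> \<in> ?Ps" for S \<pi>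
  proof -
    have "y (S, \<pi>) (Suc i) < y (S, \<pi>) i \<longleftrightarrow> \<pi> (Suc i) < \<pi> i" if "i \<in> {1..<m}" for i
      using nth(1)[OF S range[OF \<pi>, of "Suc i"] range[OF \<pi>, of i]] that unfolding y_def by auto
    then have "{i \<in> {1..<m}. y (S, \<pi>) (Suc i) < y (S, \<pi>) i} = {i \<in> {1..<m}. \<pi> (Suc i) < \<pi> i}" by blast
    then show ?thesis using \<pi> by simp
  qed
  have "x ` (?Ss \<times> ?Ps) \<subseteq> sum_tuples n m ((d + 1) * n + m)"
  proof (rule image_subsetI)
    fix p assume "p \<in> ?Ss \<times> ?Ps"
    then obtain S \<pi> where p: "p = (S, \<pi>)" and S: "S \<in> ?Ss" and \<pi>: "\<pi> \<in> ?Ps" by blast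
    let ?y = "y (S, \<pi>)"
    have yl: "?y j < n" if "j \<le> m" for j using y_less[OF S \<pi> that] .
    have y0: "?y 0 = 0" unfolding y_def by simp
    have rng: "x (S, \<pi>) \<in> {0..m} \<rightarrow>\<^sub>E {1..n}"
    proof
      fix j assume j: "j \<in> {0..m}"
      then have "cyclic_diff n (?y (j - 1)) (?y j) < n" by (intro cyclic_diff_less yl) auto
      then show "x (S, \<pi>) j \<in> {1..n}"
        using yl[of m] j unfolding x_def by (auto simp: Suc_le_eq)
    qed (auto simp: x_def)
    have "(\<Sum>j\<in>{0..m}. x (S, \<pi>) j) = x (S, \<pi>) 0 + (\<Sum>j=1..m. x (S, \<pi>) j)"
      by (simp add: sum.atLeast_Suc_atMost)
    also have "(\<Sum>j=1..m. x (S, \<pi>) j) = (\<Sum>j=1..m. 1 + cyclic_diff n (?y (j - 1)) (?y j))"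
      unfolding x_def by (intro sum.cong) auto
    also have "\<dots> = m + (\<Sum>j=1..m. cyclic_diff n (?y (j - 1)) (?y j))"
      by (simp only: sum.distrib) simp
    also have "(\<Sum>j=1..m. cyclic_diff n (?y (j - 1)) (?y j)) = ?y m + n * d"
      using sum_cyclic_diff[of ?y m n, OF y0 yl] desc[OF S \<pi>] by simp
    also have "x (S, \<pi>) 0 + (m + (?y m + n * d)) = (d + 1) * n + m"
      using yl[of m] unfolding x_def by simp
    finally show "x p \<in> sum_tuples n m ((d + 1) * n + m)"
      using rng unfolding sum_tuples_def p by simp
  qed
  moreover have "inj_on x (?Ss \<times> ?Ps)"
  proof (rule inj_onI)
    fix p p' assume "p \<in> ?Ss \<times> ?Ps" "p' \<in> ?Ss \<times> ?Ps" and xx: "x p = x p'"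
    then obtain S \<pi> S' \<pi>' where p: "p = (S, \<pi>)" "p' = (S', \<pi>')"
      and mem: "S \<in> ?Ss" "S' \<in> ?Ss" "\<pi> \<in> ?Ps" "\<pi>' \<in> ?Ps" by blast
    have eq: "x (S, \<pi>) = x (S', \<pi>')" using xx unfolding p .
    \<comment> \<open>Starting from \<open>y 0 = 0\<close>, the cyclic differences recover the
      sequence term by term.\<close>
    have y_eq: "y (S, \<pi>) j = y (S', \<pi>') j" if "j \<le> m" for j
      using that
    proof (induction j)
      case (Suc j)
      have "cyclic_diff n (y (S, \<pi>) j) (y (S, \<pi>) (Suc j)) = cyclic_diff n (y (S', \<pi>') j) (y (S', \<pi>') (Suc j))"
        using fun_cong[OF eq, of "Suc j"] Suc.prems unfolding x_def by simp
      then show ?case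
        using Suc y_less[OF mem(1,3)] y_less[OF mem(2,4)] cyclic_diff_inj
        by (metis Suc_leD)
    qed (simp add: y_def)
    \<comment> \<open>\<open>S\<close> is the set of values of the sequence; \<pi> is then read off
      from the relative order of these values.\<close>
    have image: "y (S, \<pi>) ` {1..m} = S" if "S \<in> ?Ss" "\<pi> \<in> ?Ps" for S \<pi>
    proof -
      let ?l = "sorted_list_of_set S"
      have fin: "finite S" using that finite_subset by blast
      have len: "length ?l = m" using that by simp
      have "y (S, \<pi>) ` {1..m} = (\<lambda>a. ?l ! (a - 1)) ` \<pi> ` {1..m}"
        unfolding y_def image_image by (intro image_cong) auto
      also have "\<pi> ` {1..m} = Suc ` {..<m}"
        using that(2) permutes_image[of \<pi> "{1..m}"] by (simp add: image_Suc_lessThan)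
      also have "(\<lambda>a. ?l ! (a - 1)) ` Suc ` {..<m} = set ?l"
        unfolding image_image using len by (auto simp: set_conv_nth image_iff)
      finally show ?thesis using fin by simp
    qed
    have "y (S, \<pi>) ` {1..m} = y (S', \<pi>') ` {1..m}" using y_eq by (intro image_cong) auto
    then have "S = S'" using image[OF mem(1,3)] image[OF mem(2,4)] by simp
    moreover have "\<pi> = \<pi>'"
    proof
      fix j
      show "\<pi> j = \<pi>' j"
      proof (cases "j \<in> {1..m}")
        case True
        then have "sorted_list_of_set S ! (\<pi> j - 1) = sorted_list_of_set S ! (\<pi>' j - 1)"
          using y_eq[of j] \<open>S = S'\<close> unfolding y_def by auto
        then have "\<not> \<pi> j < \<pi>' j" "\<not> \<pi>' j < \<pi> j"
          using nth(1)[OF mem(1) range[OF mem(3) True] range[OF mem(4) True]]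
            nth(1)[OF mem(1) range[OF mem(4) True] range[OF mem(3) True]] by auto
        then show ?thesis by simp
      next
        case False
        then show ?thesis using mem(3,4) permutes_not_in[of \<pi> _ j] permutes_not_in[of \<pi>' _ j] by auto
      qed
    qed
    ultimately show "p = p'" unfolding p by blast
  qed
  ultimately have "card (?Ss \<times> ?Ps) \<le> card (sum_tuples n m ((d + 1) * n + m))"
    by (intro card_inj_on_le) auto
  then show ?thesis unfolding card_cartesian_product eulerian_def using n_subsets[of "{..<n}" m] by simp
qed

text \<open>The other \<open>m - 1\<close> coordinates determine the tuple, because the prescribed
  sum gives twice the repeated value.\<close>

lemma card_sum_tuples_with_repetition:
  assumes "a \<in> {0..m}" "b \<in> {0..m}" "a \<noteq> b"
  shows "card {x \<in> sum_tuples n m s. x a = x b} \<le> n ^ (m - 1)"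
proof -
  let ?J = "{0..m} - {a, b}"
  have "inj_on (\<lambda>x. restrict x ?J) {x \<in> sum_tuples n m s. x a = x b}"
  proof (rule inj_onI, clarify)
    fix x x' assume x: "x \<in> sum_tuples n m s" "x a = x b" and x': "x' \<in> sum_tuples n m s" "x' a = x' b"
      and eq: "restrict x ?J = restrict x' ?J"
    have J: "x j = x' j" if "j \<in> ?J" for j using fun_cong[OF eq, of j] that by (simp add: restrict_def split: if_splits)
    have split: "(\<Sum>j\<in>{0..m}. z j) = z a + (z b + (\<Sum>j\<in>?J. z j))" for z :: "nat \<Rightarrow> nat"
    proof -
      have "?J = {0..m} - {a} - {b}" by auto
      then show ?thesis using assms by (simp add: sum.remove[of _ a] sum.remove[of _ b])
    qed
    have "(\<Sum>j\<in>?J. x j) = (\<Sum>j\<in>?J. x' j)" using J by (intro sum.cong) auto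
    then have "x a = x' a"
      using x x' split[of x] split[of x'] unfolding sum_tuples_def by simp
    then have "x j = x' j" if "j \<in> {0..m}" for j
      using J[of j] that x(2) x'(2) by (cases "j = a \<or> j = b") auto
    moreover have "x \<in> {0..m} \<rightarrow>\<^sub>E {1..n}" "x' \<in> {0..m} \<rightarrow>\<^sub>E {1..n}"
      using x x' unfolding sum_tuples_def by auto
    ultimately show "x = x'" by (intro PiE_ext)
  qed
  moreover have "(\<lambda>x. restrict x ?J) ` {x \<in> sum_tuples n m s. x a = x b} \<subseteq> ?J \<rightarrow>\<^sub>E {1..n}"
  proof clarify
    fix x assume "x \<in> sum_tuples n m s"
    then have "x \<in> {0..m} \<rightarrow>\<^sub>E {1..n}" unfolding sum_tuples_def by simp
    then have "x \<in> ?J \<rightarrow> {1..n}" by auto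
    then show "restrict x ?J \<in> ?J \<rightarrow>\<^sub>E {1..n}" by (simp only: restrict_PiE)
  qed
  ultimately have "card {x \<in> sum_tuples n m s. x a = x b} \<le> card (?J \<rightarrow>\<^sub>E {1..n})"
    by (intro card_inj_on_le) (auto intro: finite_PiE)
  also have "\<dots> = n ^ card ?J" by (simp add: card_funcsetE)
  also have "card ?J = m - 1" using assms by (simp add: card_Diff_subset)
  finally show ?thesis .
qed

text \<open>A set of the level is listed by \<open>fact (m + 1)\<close> injective tuples. Every
  other tuple repeats a value at one of at most \<open>(m + 1)\<^sup>2\<close> pairs of
  positions.\<close>

lemma card_sum_tuples_le:
  "card (sum_tuples n m s) \<le> card (sum_level n (m + 1) s) * fact (m + 1) + (m + 1)\<^sup>2 * n ^ (m - 1)"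
proof -
  let ?I = "{0..m}" and ?T = "sum_tuples n m s"
  define good where "good = {x \<in> ?T. inj_on x ?I}"
  define bad where "bad = {x \<in> ?T. \<not> inj_on x ?I}"
  define off_diag where "off_diag = {(a, b) \<in> ?I \<times> ?I. a \<noteq> b}"
  have fin: "finite off_diag" unfolding off_diag_def by (rule finite_subset[of _ "?I \<times> ?I"]) auto
  have "card off_diag \<le> card (?I \<times> ?I)" unfolding off_diag_def by (intro card_mono) auto
  then have card_off_diag: "card off_diag \<le> (m + 1)\<^sup>2" by (simp add: power2_eq_square)
  have "bad \<subseteq> (\<Union>(a, b)\<in>off_diag. {x \<in> ?T. x a = x b})"
    unfolding bad_def inj_on_def off_diag_def by fastforce
  then have "card bad \<le> card (\<Union>(a, b)\<in>off_diag. {x \<in> ?T. x a = x b})"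
    using fin by (intro card_mono finite_UN_I) auto
  also have "\<dots> \<le> (\<Sum>(a, b)\<in>off_diag. card {x \<in> ?T. x a = x b})"
    using card_UN_le[OF fin, of "\<lambda>(a, b). {x \<in> ?T. x a = x b}"] by (simp add: case_prod_unfold)
  also have "\<dots> \<le> (\<Sum>(a, b)\<in>off_diag. n ^ (m - 1))"
    using card_sum_tuples_with_repetition unfolding off_diag_def by (intro sum_mono) auto
  also have "\<dots> \<le> (m + 1)\<^sup>2 * n ^ (m - 1)" using card_off_diag by simp
  finally have bad: "card bad \<le> (m + 1)\<^sup>2 * n ^ (m - 1)" .
  have "good \<subseteq> (\<Union>X\<in>sum_level n (m + 1) s. {x \<in> ?I \<rightarrow>\<^sub>E X. inj_on x ?I})"
  proof
    fix x assume "x \<in> good"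
    then have x: "x \<in> ?I \<rightarrow>\<^sub>E {1..n}" "(\<Sum>j\<in>?I. x j) = s" "inj_on x ?I"
      unfolding good_def sum_tuples_def by auto
    have "x ` ?I \<in> sum_level n (m + 1) s"
      using x unfolding sum_level_def ksubsets_def by (auto simp: card_image sum.reindex)
    moreover have "x \<in> ?I \<rightarrow>\<^sub>E x ` ?I" using x(1) by (auto simp: PiE_iff)
    ultimately show "x \<in> (\<Union>X\<in>sum_level n (m + 1) s. {x \<in> ?I \<rightarrow>\<^sub>E X. inj_on x ?I})" using x(3) by blast
  qed
  then have "card good \<le> card (\<Union>X\<in>sum_level n (m + 1) s. {x \<in> ?I \<rightarrow>\<^sub>E X. inj_on x ?I})"
  proof (intro card_mono finite_UN_I)
    fix X assume "X \<in> sum_level n (m + 1) s"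
    then have "finite X" using ksubsets_finite unfolding sum_level_def by blast
    then have "finite (?I \<rightarrow>\<^sub>E X)" by (intro finite_PiE) auto
    then show "finite {x \<in> ?I \<rightarrow>\<^sub>E X. inj_on x ?I}" by simp
  qed simp
  also have "\<dots> \<le> (\<Sum>X\<in>sum_level n (m + 1) s. card {x \<in> ?I \<rightarrow>\<^sub>E X. inj_on x ?I})"
    by (intro card_UN_le) simp
  also have "\<dots> = (\<Sum>X\<in>sum_level n (m + 1) s. fact (m + 1))"
  proof (intro sum.cong refl)
    fix X assume "X \<in> sum_level n (m + 1) s"
    then have "X \<in> ksubsets n (m + 1)" unfolding sum_level_def by simp
    then have "finite X" "card X = m + 1" by (simp_all add: ksubsets_finite) (simp add: ksubsets_def)
    then show "card {x \<in> ?I \<rightarrow>\<^sub>E X. inj_on x ?I} = fact (m + 1)"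
      using card_inj_on_subset_funcset[of ?I X ?I] by (simp add: fact_prod_rev)
  qed
  also have "\<dots> = card (sum_level n (m + 1) s) * fact (m + 1)" by simp
  finally have good: "card good \<le> card (sum_level n (m + 1) s) * fact (m + 1)" .
  have "?T = good \<union> bad" unfolding good_def bad_def by auto
  then have "card ?T \<le> card good + card bad" using card_Un_le by metis
  then show ?thesis using good bad by linarith
qed

section \<open>Asymptotics\<close>

text \<open>The left factor of the falling factorial loses at most \<open>m * n ^ m\<close> when
  \<open>n - m\<close> replaces \<open>n\<close>, and
  \<open>m\<^sup>2 + m \<le> (m + 1)\<^sup>2\<close> absorbs this loss in the induction.\<close>

lemma binomial_fact_ge:
  assumes "m \<le> n"
  shows "real n ^ m - (real m)\<^sup>2 * real n ^ (m - 1) \<le> real (n choose m) * fact m"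
  using assms
proof (induction m)
  case (Suc m)
  have "Suc m * (n choose Suc m) = (n - m) * (n choose m)"
    using binomial_absorption[of m n] binomial_absorb_comp[of n m] by simp
  then have "real (Suc m * (n choose Suc m)) = real ((n - m) * (n choose m))" by (rule arg_cong)
  then have absorb: "real (Suc m) * real (n choose Suc m) = (real n - real m) * real (n choose m)"
    using Suc.prems by (simp only: of_nat_mult of_nat_diff[OF Suc_leD])
  have "real (n choose Suc m) * fact (Suc m) = (real (Suc m) * real (n choose Suc m)) * fact m"
    by simp
  then have step: "real (n choose Suc m) * fact (Suc m) = (real n - real m) * (real (n choose m) * fact m)"
    unfolding absorb by (simp only: mult.assoc)
  show ?case
  proof (cases "m = 0")
    case False
    then have pow: "real n ^ m = real n * real n ^ (m - 1)" by (simp add: power_eq_if)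
    have "real n ^ Suc m - (real (Suc m))\<^sup>2 * real n ^ m \<le>
        (real n - real m) * (real n ^ m - (real m)\<^sup>2 * real n ^ (m - 1))"
    proof -
      have "(real n - real m) * (real n ^ m - (real m)\<^sup>2 * real n ^ (m - 1)) = real n ^ Suc m
          - real m * real n ^ m - (real m)\<^sup>2 * (real n * real n ^ (m - 1)) + real m ^ 3 * real n ^ (m - 1)"
        by (simp add: algebra_simps power2_eq_square power3_eq_cube)
      note expand = this[folded pow]
      have "(real (Suc m))\<^sup>2 * real n ^ m =
          (real m)\<^sup>2 * real n ^ m + 2 * (real m * real n ^ m) + real n ^ m"
        by (simp add: algebra_simps power2_eq_square)
      moreover have "real m * real n ^ m \<ge> 0" "real n ^ m \<ge> 0" "real m ^ 3 * real n ^ (m - 1) \<ge> 0" by auto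
      ultimately show ?thesis using expand by linarith
    qed
    also have "\<dots> \<le> (real n - real m) * (real (n choose m) * fact m)"
      using Suc by (intro mult_left_mono) auto
    finally show ?thesis unfolding step diff_Suc_1 .
  qed simp
qed simp

lemma binomial_le_power_over_fact: "real (n choose m) \<le> real n ^ m / fact m"
proof -
  have "real ((n choose m) * fact m) \<le> real (n ^ m)" using binomial_fact_pow[of n m] of_nat_mono by blast
  then show ?thesis by (simp add: field_simps)
qed

text \<open>Tuples of sum \<open>(d + 1) * n + m\<close> are bounded from below by permutations with
  \<open>d\<close> descents and from above by the level sets. The error stays explicit, so its
  constant visibly depends on \<open>k\<close> and \<open>d\<close> only.\<close>

lemma log_card_dual_higher_bruhat_ge:
  assumes k: "k \<ge> 3" "k < n"
  shows "real (eulerian (k - 2) d) * real n ^ (k - 2) / (fact (k - 2) * fact (k - 1))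
      - (real (eulerian (k - 2) d) * (real (k - 2))\<^sup>2 / (fact (k - 2) * fact (k - 1))
         + (real (k - 1))\<^sup>2 / fact (k - 1)) * real n ^ (k - 3)
    \<le> log 2 (real (card (dual_higher_bruhat n k)))"
proof -
  define m where "m = k - 2"
  define s where "s = (d + 1) * n + m"
  define A where "A = real (eulerian m d)"
  define L where "L = card (sum_level n (m + 1) s)"
  have m: "m \<ge> 1" "k - 1 = m + 1" "k - 3 = m - 1" "m \<le> n" using k unfolding m_def by auto
  have "(n choose m) * eulerian m d \<le> L * fact (m + 1) + (m + 1)\<^sup>2 * n ^ (m - 1)"
    using card_sum_tuples_ge[OF m(1), of n d] card_sum_tuples_le[of n m s] unfolding s_def L_def by linarith
  then have "real ((n choose m) * eulerian m d) \<le> real (L * fact (m + 1) + (m + 1)\<^sup>2 * n ^ (m - 1))"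
    by (rule of_nat_mono)
  then have tuples: "A * real (n choose m) \<le> real L * fact (m + 1) + (real (m + 1))\<^sup>2 * real n ^ (m - 1)"
    unfolding A_def by (simp add: mult.commute del: fact_Suc)
  have "A * ((real n ^ m - (real m)\<^sup>2 * real n ^ (m - 1)) / fact m) \<le> A * real (n choose m)"
    using binomial_fact_ge[OF m(4)] unfolding A_def by (intro mult_left_mono) (auto simp: field_simps)
  with tuples have "A * ((real n ^ m - (real m)\<^sup>2 * real n ^ (m - 1)) / fact m)
      - (real (m + 1))\<^sup>2 * real n ^ (m - 1) \<le> real L * fact (m + 1)" by linarith
  then have "(A * ((real n ^ m - (real m)\<^sup>2 * real n ^ (m - 1)) / fact m)
      - (real (m + 1))\<^sup>2 * real n ^ (m - 1)) / fact (m + 1) \<le> real L"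
    by (subst pos_divide_le_eq) (auto simp del: fact_Suc)
  moreover have "(A * ((real n ^ m - (real m)\<^sup>2 * real n ^ (m - 1)) / fact m)
      - (real (m + 1))\<^sup>2 * real n ^ (m - 1)) / fact (m + 1) =
     A * real n ^ m / (fact m * fact (m + 1))
      - (A * (real m)\<^sup>2 / (fact m * fact (m + 1)) + (real (m + 1))\<^sup>2 / fact (m + 1)) * real n ^ (m - 1)"
    by (simp add: field_simps del: fact_Suc of_nat_Suc)
  moreover have "real L \<le> log 2 (real (card (dual_higher_bruhat n k)))"
  proof -
    have "2 ^ L \<le> card (dual_higher_bruhat n k)"
      using card_dual_higher_bruhat_ge[of k n s] k m(2) unfolding L_def by simp
    then have "real (2 ^ L) \<le> real (card (dual_higher_bruhat n k))" by (rule of_nat_mono)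
    then have "2 ^ L \<le> real (card (dual_higher_bruhat n k))" by simp
    then show ?thesis by (subst le_log_iff) (auto simp: powr_realpow intro: less_le_trans[of 0 "2 ^ L"])
  qed
  ultimately show ?thesis unfolding A_def m(2,3) m_def[symmetric] by linarith
qed

text \<open>The factor \<open>2 ^ (n choose (k - 2))\<close> yields the leading term; the polynomial
  factors, one per \<open>(k-3)\<close>-set, yield the logarithmic error.\<close>

lemma log_card_dual_higher_bruhat_le:
  assumes k: "k \<ge> 3" "k < n"
  shows "log 2 (real (card (dual_higher_bruhat n k)))
    \<le> real n ^ (k - 2) / fact (k - 2) + real n ^ (k - 3) * log 2 (8 * (real n + 2)\<^sup>2)"
proof -
  let ?c = "card (dual_higher_bruhat n k)" and ?b = "8 * (n + 2)\<^sup>2"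
  \<comment> \<open>Monotonicity of the logarithm needs a positive cardinality, which the lower
    bound supplies for any level, here sum \<open>0\<close>.\<close>
  have "(0 :: nat) < 2 ^ card (sum_level n (k - 1) 0)" by simp
  also have "\<dots> \<le> ?c" using card_dual_higher_bruhat_ge[of k n 0] k by simp
  finally have pos: "0 < ?c" .
  have "real ?c \<le> real (?b ^ (n choose (k - 3)) * 2 ^ (n choose (k - 2)))"
    using card_dual_higher_bruhat_le[OF k(1)] by (intro of_nat_mono)
  then have "log 2 (real ?c) \<le> log 2 (real (?b ^ (n choose (k - 3)) * 2 ^ (n choose (k - 2))))"
    using pos by (intro log_mono) auto
  also have "\<dots> = real (n choose (k - 3)) * log 2 (real ?b) + real (n choose (k - 2))"
  proof -
    have "log 2 (b ^ c * 2 ^ e) = real c * log 2 b + real e" if "b > 0" for b c e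
      using that by (simp add: log_mult log_nat_power)
    from this[of "real ?b"] show ?thesis by (simp only: of_nat_mult of_nat_power of_nat_numeral) simp
  qed
  also have "\<dots> \<le> real n ^ (k - 3) * log 2 (real ?b) + real n ^ (k - 2) / fact (k - 2)"
  proof (intro add_mono mult_right_mono binomial_le_power_over_fact)
    have "real (n choose (k - 3)) \<le> real n ^ (k - 3) / fact (k - 3)" by (rule binomial_le_power_over_fact)
    also have "\<dots> \<le> real n ^ (k - 3) / 1" by (intro divide_left_mono) auto
    finally show "real (n choose (k - 3)) \<le> real n ^ (k - 3)" by simp
    have "1 \<le> ?b" by simp
    then have "1 \<le> real ?b" using of_nat_mono[of 1 ?b, where 'a = real] by (simp only: of_nat_1)
    then show "0 \<le> log 2 (real ?b)" by (subst zero_le_log_cancel_iff) linarith+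
  qed
  finally show ?thesis by (simp add: add.commute)
qed

theorem theorem46:
  fixes k :: nat
  assumes "k \<ge> 3"
  shows "\<exists>(f :: nat \<Rightarrow> real) (g :: nat \<Rightarrow> real).
    f \<in> O(\<lambda>n. real n ^ (k - 3)) \<and>
    g \<in> O(\<lambda>n. real n ^ (k - 3) * ln (real n)) \<and>
    (\<forall>\<^sub>F n in sequentially.
       real (eulerian (k - 2) ((k - 3) div 2)) * real n ^ (k - 2) / (fact (k - 2) * fact (k - 1)) + f n
         \<le> log 2 (real (card (dual_higher_bruhat n k))) \<and>
       log 2 (real (card (dual_higher_bruhat n k)))
         \<le> real n ^ (k - 2) / fact (k - 2) + g n)"
proof -
  \<comment> \<open>The lower bound is available for every \<open>d\<close>; the central value
    \<open>(k - 3) div 2\<close> makes the Eulerian number largest.\<close>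
  define A where "A = real (eulerian (k - 2) ((k - 3) div 2))"
  define c where "c = A * (real (k - 2))\<^sup>2 / (fact (k - 2) * fact (k - 1)) + (real (k - 1))\<^sup>2 / fact (k - 1)"
  let ?f = "\<lambda>n. - c * real n ^ (k - 3)"
  let ?g = "\<lambda>n. real n ^ (k - 3) * log 2 (8 * (real n + 2)\<^sup>2)"
  have "?f \<in> O(\<lambda>n. real n ^ (k - 3))" by simp
  moreover have "?g \<in> O(\<lambda>n. real n ^ (k - 3) * ln (real n))"
  proof (rule landau_o.big.mult)
    show "(\<lambda>n. log 2 (8 * (real n + 2)\<^sup>2)) \<in> O(\<lambda>n. ln (real n))" by real_asymp
  qed simp
  moreover have "\<forall>\<^sub>F n in sequentially.
       A * real n ^ (k - 2) / (fact (k - 2) * fact (k - 1)) + ?f n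
         \<le> log 2 (real (card (dual_higher_bruhat n k))) \<and>
       log 2 (real (card (dual_higher_bruhat n k))) \<le> real n ^ (k - 2) / fact (k - 2) + ?g n"
    using eventually_gt_at_top[of k]
  proof eventually_elim
    case (elim n)
    show ?case
      using log_card_dual_higher_bruhat_ge[OF assms elim, of "(k - 3) div 2"]
        log_card_dual_higher_bruhat_le[OF assms elim]
      unfolding c_def A_def by (simp only: mult_minus_left add_uminus_conv_diff)
  qed
  ultimately show ?thesis unfolding A_def by blast
qed

end
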